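(* Let $\Gamma$ be a finite simplicial graph with vertex set $V(\Gamma)$ and edge set $E(\Gamma)$, let $m : E(\Gamma) \to \mathbb{N}_{\ge 2}$ be a labeling, and let $A = A[\Gamma]$ be the Artin group of $\Gamma$. Let $X, Y \subset V(\Gamma)$ and $\alpha \in A$ be such that $\alpha A_Y \alpha^{-1} \subset A_X$. Then there exist $Y' \subset X$ and $\gamma \in A_X$ such that $\alpha A_Y \alpha^{-1} = \gamma A_{Y'} \gamma^{-1}$.
   Context: For letters $a,b$ and an integer $m \ge 2$, $\mathrm{Prod}(a,b,m)$ denotes the alternating word $aba\cdots$ of length $m$ (starting with $a$). Given a finite simplicial graph $\Gamma$ with a labeling $m : E(\Gamma) \to \mathbb{N}_{\ge 2}$ of its edges, take an abstract set $\Sigma = \{\sigma_x \mid x \in V(\Gamma)\}$ in one-to-one correspondence with $V(\Gamma)$. The Artin group of $\Gamma$ is $$A = A[\Gamma] = \langle \Sigma \mid \mathrm{Prod}(\sigma_x,\sigma_y,m(e)) = \mathrm{Prod}(\sigma_y,\sigma_x,m(e)) \text{ for } e = \{x,y\} \in E(\Gamma) \rangle.$$ (There is no relation between $\sigma_x$ and $\sigma_y$ when $\{x,y\}$ is not an edge.) For $X \subset V(\Gamma)$, $A_X$ denotes the subgroup of $A$ generated by $\Sigma_X = \{\sigma_x \mid x \in X\}$. *)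

theory Defs
  imports "HOL-Algebra.Generated_Groups"
begin

section \<open>Groups given by generators and relations\<close>

text \<open>
  A letter \<open>(x, True)\<close> stands for the generator \<open>x\<close> and \<open>(x, False)\<close> for its formal inverse.
  A relation \<open>u = v\<close> is a pair \<open>(u, v)\<close> of words.
\<close>

type_synonym 'x word = "('x \<times> bool) list"

definition words :: "'x set \<Rightarrow> 'x word set" where
  "words S = lists (S \<times> UNIV)"

text \<open>
  The smallest monoid congruence on the words over \<open>S\<close> that contains the relations \<open>R\<close> and the
  cancellations of a letter against its inverse.
\<close>

inductive pres_eq :: "'x set \<Rightarrow> ('x word \<times> 'x word) set \<Rightarrow> 'x word \<Rightarrow> 'x word \<Rightarrow> bool"
  for S R where
  relation: "(u, v) \<in> R \<Longrightarrow> pres_eq S R u v"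
| cancel: "x \<in> S \<Longrightarrow> pres_eq S R [(x, b), (x, \<not> b)] []"
| refl: "w \<in> words S \<Longrightarrow> pres_eq S R w w"
| sym: "pres_eq S R u v \<Longrightarrow> pres_eq S R v u"
| trans: "pres_eq S R u v \<Longrightarrow> pres_eq S R v w \<Longrightarrow> pres_eq S R u w"
| append: "pres_eq S R u u' \<Longrightarrow> pres_eq S R v v' \<Longrightarrow> pres_eq S R (u @ v) (u' @ v')"

definition pres_rel :: "'x set \<Rightarrow> ('x word \<times> 'x word) set \<Rightarrow> ('x word \<times> 'x word) set" where
  "pres_rel S R = {(u, v). pres_eq S R u v}"

definition pres_group :: "'x set \<Rightarrow> ('x word \<times> 'x word) set \<Rightarrow> 'x word set monoid" where
  "pres_group S R =
    \<lparr>carrier = words S // pres_rel S R,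
     monoid.mult = (\<lambda>P Q. \<Union>u\<in>P. \<Union>v\<in>Q. pres_rel S R `` {u @ v}),
     one = pres_rel S R `` {[]}\<rparr>"

definition pres_gen :: "'x set \<Rightarrow> ('x word \<times> 'x word) set \<Rightarrow> 'x \<Rightarrow> 'x word set" where
  "pres_gen S R x = pres_rel S R `` {[(x, True)]}"

locale group_presentation =
  fixes S :: "'x set" and R :: "('x word \<times> 'x word) set"
  assumes relations_subset: "R \<subseteq> words S \<times> words S"
begin

abbreviation cls :: "'x word \<Rightarrow> 'x word set" where
  "cls w \<equiv> pres_rel S R `` {w}"

lemma words_append: "u \<in> words S \<Longrightarrow> v \<in> words S \<Longrightarrow> u @ v \<in> words S"
  by (simp add: words_def)

lemma words_Nil: "[] \<in> words S"
  by (simp add: words_def)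

lemma pres_eq_words: "pres_eq S R u v \<Longrightarrow> u \<in> words S \<and> v \<in> words S"
proof (induction rule: pres_eq.induct)
  case (relation u v)
  then show ?case using relations_subset by auto
qed (auto simp: words_def)

lemma equiv_pres_rel: "equiv (words S) (pres_rel S R)"
  unfolding pres_rel_def
  by (intro equivI refl_onI symI transI)
     (auto dest: pres_eq_words intro: pres_eq.refl pres_eq.sym pres_eq.trans)

lemma cls_eq_iff:
  "u \<in> words S \<Longrightarrow> v \<in> words S \<Longrightarrow> cls u = cls v \<longleftrightarrow> pres_eq S R u v"
  using eq_equiv_class_iff[OF equiv_pres_rel] by (auto simp: pres_rel_def)

lemma cls_carrier: "u \<in> words S \<Longrightarrow> cls u \<in> carrier (pres_group S R)"
  by (simp add: pres_group_def quotientI)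

lemma carrier_cases:
  assumes "P \<in> carrier (pres_group S R)"
  obtains u where "u \<in> words S" "P = cls u"
  using assms by (auto simp: pres_group_def elim: quotientE)

lemma mult_cls:
  assumes "u \<in> words S" "v \<in> words S"
  shows "cls u \<otimes>\<^bsub>pres_group S R\<^esub> cls v = cls (u @ v)"
proof -
  have 1: "cls (u' @ v') = cls (u @ v)" if "u' \<in> cls u" "v' \<in> cls v" for u' v'
  proof -
    have e: "pres_eq S R (u @ v) (u' @ v')"
      using that by (auto simp: pres_rel_def intro: pres_eq.append)
    with pres_eq_words[OF e] show ?thesis
      using cls_eq_iff by blast
  qed
  have 2: "u \<in> cls u" "v \<in> cls v"
    using assms by (auto simp: pres_rel_def intro: pres_eq.refl)
  have "(\<Union>u'\<in>cls u. \<Union>v'\<in>cls v. cls (u' @ v')) = cls (u @ v)"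
    using 1 2 by blast
  then show ?thesis
    by (simp add: pres_group_def)
qed

lemma one_cls: "\<one>\<^bsub>pres_group S R\<^esub> = cls []"
  by (simp add: pres_group_def)

lemma left_inverse:
  assumes "u \<in> words S"
  shows "\<exists>v\<in>words S. pres_eq S R (v @ u) []"
  using assms
proof (induction u)
  case Nil
  then show ?case by (auto intro!: bexI[of _ "[]"] pres_eq.refl simp: words_def)
next
  case (Cons l u)
  obtain x b where l: "l = (x, b)" by (cases l)
  have x: "x \<in> S" and u: "u \<in> words S" using Cons.prems by (auto simp: words_def l)
  obtain v where v: "v \<in> words S" "pres_eq S R (v @ u) []" using Cons.IH[OF u] by blast
  have "pres_eq S R [(x, \<not> b), (x, b)] []"
    using pres_eq.cancel[OF x, of R "\<not> b"] by simp
  then have "pres_eq S R ([(x, \<not> b), (x, b)] @ u) ([] @ u)"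
    using pres_eq.refl[OF u] by (rule pres_eq.append)
  then have "pres_eq S R (v @ [(x, \<not> b), (x, b)] @ u) (v @ [] @ u)"
    using pres_eq.append[OF pres_eq.refl[OF v(1)]] by blast
  then have "pres_eq S R ((v @ [(x, \<not> b)]) @ l # u) []"
    using v(2) by (auto simp: l intro: pres_eq.trans)
  moreover have "v @ [(x, \<not> b)] \<in> words S" using v x by (simp add: words_def)
  ultimately show ?case by blast
qed

theorem group_pres_group: "group (pres_group S R)"
proof (rule groupI)
  fix P Q assume "P \<in> carrier (pres_group S R)" "Q \<in> carrier (pres_group S R)"
  then show "P \<otimes>\<^bsub>pres_group S R\<^esub> Q \<in> carrier (pres_group S R)"
    by (elim carrier_cases) (simp add: mult_cls cls_carrier words_append)
next
  show "\<one>\<^bsub>pres_group S R\<^esub> \<in> carrier (pres_group S R)"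
    by (simp add: one_cls cls_carrier words_Nil)
next
  fix P Q T
  assume "P \<in> carrier (pres_group S R)" "Q \<in> carrier (pres_group S R)"
    "T \<in> carrier (pres_group S R)"
  then show "P \<otimes>\<^bsub>pres_group S R\<^esub> Q \<otimes>\<^bsub>pres_group S R\<^esub> T =
      P \<otimes>\<^bsub>pres_group S R\<^esub> (Q \<otimes>\<^bsub>pres_group S R\<^esub> T)"
    by (elim carrier_cases) (simp add: mult_cls words_append)
next
  fix P assume "P \<in> carrier (pres_group S R)"
  then show "\<one>\<^bsub>pres_group S R\<^esub> \<otimes>\<^bsub>pres_group S R\<^esub> P = P"
    by (elim carrier_cases) (simp add: one_cls mult_cls words_Nil)
next
  fix P assume "P \<in> carrier (pres_group S R)"
  then obtain u where u: "u \<in> words S" "P = cls u" by (rule carrier_cases)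
  obtain v where "v \<in> words S" "pres_eq S R (v @ u) []" using left_inverse[OF u(1)] by blast
  then show "\<exists>Q\<in>carrier (pres_group S R). Q \<otimes>\<^bsub>pres_group S R\<^esub> P = \<one>\<^bsub>pres_group S R\<^esub>"
    using u by (intro bexI[of _ "cls v"])
      (auto simp: mult_cls one_cls cls_eq_iff words_append words_Nil cls_carrier)
qed

lemma pres_gen_carrier: "x \<in> S \<Longrightarrow> pres_gen S R x \<in> carrier (pres_group S R)"
  unfolding pres_gen_def by (rule cls_carrier) (simp add: words_def)

lemma inv_pres_gen:
  assumes "x \<in> S"
  shows "inv\<^bsub>pres_group S R\<^esub> (pres_gen S R x) = cls [(x, False)]"
proof -
  interpret G: group "pres_group S R" by (rule group_pres_group)
  have "pres_eq S R [(x, False), (x, True)] []"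
    using pres_eq.cancel[OF assms, of R False] by simp
  then have "cls [(x, False)] \<otimes>\<^bsub>pres_group S R\<^esub> pres_gen S R x = \<one>\<^bsub>pres_group S R\<^esub>"
    using assms unfolding pres_gen_def
    by (subst mult_cls) (auto simp: one_cls cls_eq_iff words_def)
  moreover have "cls [(x, False)] \<in> carrier (pres_group S R)"
    using assms by (intro cls_carrier) (simp add: words_def)
  ultimately show ?thesis
    using G.inv_equality pres_gen_carrier[OF assms] by blast
qed

theorem carrier_pres_group_generate:
  "carrier (pres_group S R) = generate (pres_group S R) (pres_gen S R ` S)"
proof
  interpret G: group "pres_group S R" by (rule group_pres_group)
  show "generate (pres_group S R) (pres_gen S R ` S) \<subseteq> carrier (pres_group S R)"
    by (rule G.generate_incl) (auto intro: pres_gen_carrier)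
  have "cls u \<in> generate (pres_group S R) (pres_gen S R ` S)" if "u \<in> words S" for u
    using that
  proof (induction u)
    case Nil
    then show ?case using generate.one[of "pres_group S R"] by (simp add: one_cls)
  next
    case (Cons l u)
    obtain x b where l: "l = (x, b)" by (cases l)
    have x: "x \<in> S" and u: "u \<in> words S" and lw: "[l] \<in> words S"
      using Cons.prems by (auto simp: words_def l)
    have "cls [l] \<in> generate (pres_group S R) (pres_gen S R ` S)"
    proof (cases b)
      case True
      then show ?thesis using x by (auto simp: l pres_gen_def[symmetric] intro: generate.incl)
    next
      case False
      then show ?thesis using x by (auto simp: l inv_pres_gen[symmetric] intro: generate.inv)
    qed
    then have "cls [l] \<otimes>\<^bsub>pres_group S R\<^esub> cls u \<in> generate (pres_group S R) (pres_gen S R ` S)"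
      using Cons.IH[OF u] by (rule generate.eng)
    then show ?case using lw u by (simp add: mult_cls)
  qed
  then show "carrier (pres_group S R) \<subseteq> generate (pres_group S R) (pres_gen S R ` S)"
    by (auto elim: carrier_cases)
qed

end

text \<open>
  Value of a word in a group \<open>G\<close> under an assignment \<open>f\<close> of the generators; it is used to state
  the universal property of the presented group.
\<close>

primrec word_value :: "('g, 'b) monoid_scheme \<Rightarrow> ('x \<Rightarrow> 'g) \<Rightarrow> 'x word \<Rightarrow> 'g" where
  "word_value G f [] = \<one>\<^bsub>G\<^esub>"
| "word_value G f (l # w) =
    (if snd l then f (fst l) else inv\<^bsub>G\<^esub> f (fst l)) \<otimes>\<^bsub>G\<^esub> word_value G f w"

context group_presentation
begin

theorem universal_property:
  assumes "group G" and f: "f \<in> S \<rightarrow> carrier G"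
    and R: "\<And>u v. (u, v) \<in> R \<Longrightarrow> word_value G f u = word_value G f v"
  shows "\<exists>h \<in> hom (pres_group S R) G. \<forall>x\<in>S. h (pres_gen S R x) = f x"
proof -
  interpret G: group G by fact
  have closed: "word_value G f w \<in> carrier G" if "w \<in> words S" for w
    using that
  proof (induction w)
    case (Cons l w)
    then have "f (fst l) \<in> carrier G" "w \<in> words S"
      using f by (auto simp: words_def)
    then show ?case using Cons.IH by simp
  qed simp
  have app: "word_value G f (u @ v) = word_value G f u \<otimes>\<^bsub>G\<^esub> word_value G f v"
    if "u \<in> words S" "v \<in> words S" for u v
    using that(1)
  proof (induction u)
    case Nil
    then show ?case using closed[OF that(2)] by simp
  next
    case (Cons l u)
    have u: "u \<in> words S" and l: "f (fst l) \<in> carrier G"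
      using Cons.prems f by (auto simp: words_def)
    show ?case using Cons.IH[OF u] closed[OF u] closed[OF that(2)] l by (simp add: G.m_assoc)
  qed
  have eq: "word_value G f u = word_value G f v" if "pres_eq S R u v" for u v
    using that
  proof (induction rule: pres_eq.induct)
    case (relation u v)
    then show ?case by (rule R)
  next
    case (cancel x b)
    then have "f x \<in> carrier G" using f by auto
    then show ?case by simp
  next
    case (append u u' v v')
    then show ?case using pres_eq_words by (simp add: app)
  qed auto
  define h where "h P = word_value G f (SOME u. u \<in> P)" for P
  have h: "h (cls u) = word_value G f u" if "u \<in> words S" for u
  proof -
    have "u \<in> cls u" using that by (auto simp: pres_rel_def intro: pres_eq.refl)
    then have "(SOME u'. u' \<in> cls u) \<in> cls u" by (rule someI)
    then have "pres_eq S R u (SOME u'. u' \<in> cls u)" by (simp add: pres_rel_def)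
    from eq[OF this] show ?thesis by (simp add: h_def)
  qed
  have "h \<in> hom (pres_group S R) G"
  proof (rule homI)
    fix P assume "P \<in> carrier (pres_group S R)"
    then show "h P \<in> carrier G" by (elim carrier_cases) (simp add: h closed)
  next
    fix P Q assume "P \<in> carrier (pres_group S R)" "Q \<in> carrier (pres_group S R)"
    then show "h (P \<otimes>\<^bsub>pres_group S R\<^esub> Q) = h P \<otimes>\<^bsub>G\<^esub> h Q"
      by (elim carrier_cases) (simp add: mult_cls h words_append app)
  qed
  moreover have "h (pres_gen S R x) = f x" if "x \<in> S" for x
  proof -
    have "f x \<in> carrier G" using f that by auto
    then show ?thesis using that unfolding pres_gen_def by (subst h) (auto simp: words_def)
  qed
  ultimately show ?thesis by blast
qed

end

section \<open>Artin groups\<close>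

locale finite_simplicial_graph =
  fixes V :: "'v set" and E :: "'v set set"
  assumes finite_vertices: "finite V"
    and edges: "e \<in> E \<Longrightarrow> e \<subseteq> V \<and> card e = 2"

primrec Prod :: "'v \<Rightarrow> 'v \<Rightarrow> nat \<Rightarrow> 'v word" where
  "Prod a b 0 = []"
| "Prod a b (Suc n) = (a, True) # Prod b a n"

definition artin_relations :: "'v set set \<Rightarrow> ('v set \<Rightarrow> nat) \<Rightarrow> ('v word \<times> 'v word) set" where
  "artin_relations E m = {(Prod x y (m {x, y}), Prod y x (m {x, y})) | x y. {x, y} \<in> E}"

text \<open>
  The vertices themselves serve as the generating symbols; the element \<open>\<sigma>\<^sub>x\<close> of the group is
  \<open>artin_gen V E m x\<close>.  Only the values of \<open>m\<close> on \<open>E\<close> matter.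
\<close>

definition artin_group :: "'v set \<Rightarrow> 'v set set \<Rightarrow> ('v set \<Rightarrow> nat) \<Rightarrow> 'v word set monoid" where
  "artin_group V E m = pres_group V (artin_relations E m)"

definition artin_gen :: "'v set \<Rightarrow> 'v set set \<Rightarrow> ('v set \<Rightarrow> nat) \<Rightarrow> 'v \<Rightarrow> 'v word set" where
  "artin_gen V E m x = pres_gen V (artin_relations E m) x"

definition standard_parabolic ::
    "'v set \<Rightarrow> 'v set set \<Rightarrow> ('v set \<Rightarrow> nat) \<Rightarrow> 'v set \<Rightarrow> 'v word set set" where
  "standard_parabolic V E m X = generate (artin_group V E m) (artin_gen V E m ` X)"

context finite_simplicial_graph
begin

lemma artin_presentation: "group_presentation V (artin_relations E m)"
proof
  have "Prod x y n \<in> words V" if "x \<in> V" "y \<in> V" for x y n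
    using that by (induction n arbitrary: x y) (auto simp: words_def)
  then show "artin_relations E m \<subseteq> words V \<times> words V"
    using edges by (fastforce simp: artin_relations_def)
qed

theorem group_artin_group: "group (artin_group V E m)"
  unfolding artin_group_def
  by (rule group_presentation.group_pres_group[OF artin_presentation])

end

end

theory Submission
  imports Defs Complex_Main
begin

text \<open>
  Let \<open>W\<close> be the group generated by the reflections \<open>s\<^sub>x\<close> of the standard geometric
  representation with simple roots \<open>\<alpha>\<^sub>x\<close>, and let \<open>\<sigma>\<^sub>x \<mapsto> s\<^sub>x\<close> be the natural map from the Artin
  group to \<open>W\<close>.  The idea is to retract the whole Artin group onto \<open>A\<^sub>X\<close> and to apply the
  retraction to the equation that expresses \<open>\<alpha> A\<^sub>Y \<alpha>\<inverse> \<subseteq> A\<^sub>X\<close>.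

  The retraction is a walk on right cosets of \<open>W\<^sub>X\<close>.  Each coset is represented by an element
  \<open>w\<close> with all \<open>w\<inverse> \<alpha>\<^sub>x\<close> (\<open>x \<in> X\<close>) nonnegative.  Reading a letter \<open>\<sigma>\<^sub>s\<^sup>\<plusminus>\<^sup>1\<close> at \<open>w\<close>, there are
  two possibilities.  If \<open>w \<alpha>\<^sub>s = \<alpha>\<^sub>x\<close> for some \<open>x \<in> X\<close>, then \<open>w s\<^sub>s = s\<^sub>x w\<close>, the coset does
  not change, and the letter \<open>\<sigma>\<^sub>x\<^sup>\<plusminus>\<^sup>1\<close> is written.  Otherwise \<open>w s\<^sub>s\<close> is again such a
  representative, the walk moves there, and nothing is written.  The word that is written
  depends, as an element of the Artin group, only on the element that is read
  (\<open>retract_word_eq\<close>).  The only relations to check are the braid relations: on the plane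
  spanned by \<open>w \<alpha>\<^sub>s\<close> and \<open>w \<alpha>\<^sub>t\<close> there are either two simple roots from \<open>X\<close>, and then the walk
  stands still and translates the braid relation into another one with the same label, or there
  is at most one, and then both sides of the relation write the same single letter, or nothing
  (\<open>retract_braid\<close>).

  Words over \<open>X\<close> are copied verbatim by the walk started at \<open>1\<close>.  Suppose \<open>\<alpha> \<beta> = \<eta> \<alpha>\<close> with
  \<open>\<beta> \<in> A\<^sub>Y\<close> and \<open>\<eta> \<in> A\<^sub>X\<close>, and let reading \<open>\<alpha>\<close> write \<open>\<gamma>\<close> and end at \<open>w\<close>.  Reading both sides
  gives \<open>\<gamma> \<beta>' = \<eta> \<gamma>\<close>, where \<open>\<beta>'\<close> is what \<open>\<beta>\<close> writes when it is read from \<open>w\<close>.  Hence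
  \<open>\<alpha> \<beta> \<alpha>\<inverse> = \<eta> = \<gamma> \<beta>' \<gamma>\<inverse>\<close>.  After multiplying \<open>\<alpha>\<close> on the right by an element of \<open>A\<^sub>Y\<close>, which
  does not affect \<open>\<alpha> A\<^sub>Y \<alpha>\<inverse>\<close>, one may take \<open>w\<close> of minimal length, so that every \<open>w \<alpha>\<^sub>y\<close> with
  \<open>y \<in> Y\<close> is nonnegative (\<open>minimal_translate\<close>).  Because \<open>\<alpha> \<sigma>\<^sub>y \<alpha>\<inverse>\<close> lies in \<open>A\<^sub>X\<close>, the root
  \<open>w \<alpha>\<^sub>y\<close> lies in the span of the \<open>\<alpha>\<^sub>x\<close>, and the choice of \<open>w\<close> then forces it to be one of them
  (\<open>conjugate_generator_stays\<close>).  So the walk from \<open>w\<close> stands still on words over \<open>Y\<close> and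
  merely renames \<open>Y\<close> to a set \<open>Y' \<subseteq> X\<close>: the elements \<open>\<beta>'\<close> run through all of \<open>A\<^sub>Y\<^sub>'\<close>.

  Two facts about \<open>W\<close> carry all this: every root \<open>w \<alpha>\<^sub>s\<close> is nonnegative or nonpositive
  (\<open>root_sign\<close>), and the reflections satisfy the braid relations (\<open>braid_refls\<close>).  Both come
  from the explicit action of alternating words on the plane of two simple roots, the first one
  with an induction on the length of words.
\<close>

section \<open>Vectors and alternating words\<close>

type_synonym 'v vec = "'v \<Rightarrow> real"

definition simple_root :: "'v \<Rightarrow> 'v vec" where
  "simple_root x = (\<lambda>u. if u = x then 1 else 0)"

definition lincomb :: "real \<Rightarrow> 'v vec \<Rightarrow> real \<Rightarrow> 'v vec \<Rightarrow> 'v vec" where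
  "lincomb a p b q = (\<lambda>u. a * p u + b * q u)"

definition nonneg :: "'v vec \<Rightarrow> bool" where
  "nonneg p \<longleftrightarrow> (\<forall>u. 0 \<le> p u)"

definition nonpos :: "'v vec \<Rightarrow> bool" where
  "nonpos p \<longleftrightarrow> (\<forall>u. p u \<le> 0)"

lemma simple_root_eq_iff [simp]: "simple_root x = simple_root y \<longleftrightarrow> x = y"
  by (auto simp: simple_root_def fun_eq_iff)

lemma nonneg_simple_root [simp]: "nonneg (simple_root x)"
  by (simp add: nonneg_def simple_root_def)

lemma nonneg_lincomb_simple_roots:
  assumes "nonneg (lincomb a (simple_root s) b (simple_root t))" "s \<noteq> t"
  shows "0 \<le> a \<and> 0 \<le> b"
proof -
  have "0 \<le> lincomb a (simple_root s) b (simple_root t) s"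
    "0 \<le> lincomb a (simple_root s) b (simple_root t) t"
    using assms(1) by (simp_all add: nonneg_def)
  then show ?thesis using assms(2) by (simp add: lincomb_def simple_root_def)
qed

fun alternating :: "'v \<Rightarrow> 'v \<Rightarrow> nat \<Rightarrow> 'v list" where
  "alternating s t 0 = []"
| "alternating s t (Suc n) = s # alternating t s n"

lemma Prod_eq_map_alternating: "Prod s t n = map (\<lambda>x. (x, True)) (alternating s t n)"
  by (induction n arbitrary: s t) auto

lemma length_alternating [simp]: "length (alternating s t n) = n"
  by (induction n arbitrary: s t) auto

lemma alternating_in_lists: "s \<in> S \<Longrightarrow> t \<in> S \<Longrightarrow> alternating s t n \<in> lists S"
  by (induction n arbitrary: s t) auto

lemma take_alternating: "k \<le> n \<Longrightarrow> take k (alternating s t n) = alternating s t k"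
proof (induction n arbitrary: s t k)
  case (Suc n)
  then show ?case by (cases k) auto
qed simp

lemma alternating_Suc_right:
  "alternating s t (Suc n) = alternating s t n @ [if even n then s else t]"
  by (induction n arbitrary: s t) auto

section \<open>The geometric representation\<close>

locale artin_graph = finite_simplicial_graph V E
  for V :: "'v set" and E :: "'v set set" +
  fixes m :: "'v set \<Rightarrow> nat"
  assumes label_ge_2: "e \<in> E \<Longrightarrow> 2 \<le> m e"
begin

text \<open>
  Non-adjacent vertices carry the label \<open>\<infinity>\<close>: \<open>- 1\<close> is the limit of \<open>- cos (\<pi> / m)\<close>.
\<close>

definition gram :: "'v \<Rightarrow> 'v \<Rightarrow> real" where
  "gram s t = (if s = t then 1 else if {s, t} \<in> E then - cos (pi / m {s, t}) else - 1)"

definition pairing :: "'v \<Rightarrow> 'v vec \<Rightarrow> real" where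
  "pairing s p = (\<Sum>u\<in>V. gram s u * p u)"

definition form :: "'v vec \<Rightarrow> 'v vec \<Rightarrow> real" where
  "form p q = (\<Sum>u\<in>V. p u * pairing u q)"

definition reflect :: "'v \<Rightarrow> 'v vec \<Rightarrow> 'v vec" where
  "reflect s p = p(s := p s - 2 * pairing s p)"

abbreviation refls :: "'v list \<Rightarrow> 'v vec \<Rightarrow> 'v vec" where
  "refls \<equiv> foldr reflect"

lemma gram_self [simp]: "gram s s = 1"
  by (simp add: gram_def)

lemma gram_commute: "gram s t = gram t s"
  by (simp add: gram_def insert_commute)

lemma gram_edge: "{s, t} \<in> E \<Longrightarrow> gram s t = - cos (pi / m {s, t})"
  using edges[of "{s, t}"] by (cases "s = t") (auto simp: gram_def)

lemma edge_distinct: "{s, t} \<in> E \<Longrightarrow> s \<noteq> t"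
  using edges[of "{s, t}"] by auto

lemma pairing_simple_root [simp]: "t \<in> V \<Longrightarrow> pairing s (simple_root t) = gram s t"
  using finite_vertices by (simp add: pairing_def simple_root_def if_distrib sum.delta cong: if_cong)

lemma pairing_lincomb: "pairing s (lincomb a p b q) = a * pairing s p + b * pairing s q"
  by (simp add: pairing_def lincomb_def algebra_simps sum.distrib sum_distrib_left)

lemma form_lincomb_left: "form (lincomb a p b q) r = a * form p r + b * form q r"
  by (simp add: form_def lincomb_def algebra_simps sum.distrib sum_distrib_left)

lemma form_commute: "form p q = form q p"
proof -
  have "form p q = (\<Sum>u\<in>V. \<Sum>v\<in>V. p u * (gram u v * q v))"
    by (simp add: form_def pairing_def sum_distrib_left)
  also have "\<dots> = (\<Sum>v\<in>V. \<Sum>u\<in>V. p u * (gram u v * q v))"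
    by (rule sum.swap)
  also have "\<dots> = form q p"
    unfolding form_def pairing_def sum_distrib_left
    by (simp add: gram_commute mult.commute mult.left_commute)
  finally show ?thesis .
qed

lemma form_simple_root [simp]: "s \<in> V \<Longrightarrow> form (simple_root s) p = pairing s p"
  using finite_vertices
  by (simp add: form_def simple_root_def if_distrib[of "\<lambda>c. c * _"] sum.delta cong: if_cong)

lemma reflect_eq_lincomb: "reflect s p = lincomb 1 p (- 2 * pairing s p) (simple_root s)"
  by (auto simp: reflect_def lincomb_def simple_root_def)

lemma reflect_lincomb: "reflect s (lincomb a p b q) = lincomb a (reflect s p) b (reflect s q)"
  by (auto simp: reflect_eq_lincomb pairing_lincomb) (auto simp: lincomb_def algebra_simps)

lemma reflect_simple_root: "s \<in> V \<Longrightarrow> reflect s (simple_root s) = lincomb (-1) (simple_root s) 0 p"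
  by (auto simp: reflect_eq_lincomb lincomb_def)

lemma reflect_reflect [simp]: "s \<in> V \<Longrightarrow> reflect s (reflect s p) = p"
proof -
  assume s: "s \<in> V"
  have "pairing s (reflect s p) = - pairing s p"
    using s by (simp add: reflect_eq_lincomb pairing_lincomb)
  then show ?thesis
    by (auto simp: reflect_def fun_eq_iff)
qed

lemma form_reflect: "s \<in> V \<Longrightarrow> form (reflect s p) (reflect s q) = form p q"
  by (simp add: reflect_eq_lincomb form_lincomb_left pairing_lincomb
        form_commute[of p "lincomb _ _ _ _"] form_commute[of q p])

lemma refls_lincomb: "refls ws (lincomb a p b q) = lincomb a (refls ws p) b (refls ws q)"
  by (induction ws) (auto simp: reflect_lincomb)

text \<open>
  The free vector \<open>q\<close> with coefficient \<open>0\<close> makes the negative of a root available in whichever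
  shape a later rewriting step needs.
\<close>

lemma refls_neg_reflect:
  "s \<in> V \<Longrightarrow> refls ws (reflect s (simple_root s)) = lincomb (-1) (refls ws (simple_root s)) 0 q"
  by (subst reflect_simple_root[where p = "simple_root s"])
     (auto simp: refls_lincomb, simp add: lincomb_def)

section \<open>Roots of rank two\<close>

text \<open>
  The Chebyshev polynomials of the second kind, shifted by one: \<open>chebyshev (cos x) n\<close> is
  \<open>sin (n x) / sin x\<close>.  The recursion also makes sense for \<open>cos x = 1\<close>, which is what pairs of
  non-adjacent vertices need.
\<close>

fun chebyshev :: "real \<Rightarrow> nat \<Rightarrow> real" where
  "chebyshev c 0 = 0"
| "chebyshev c (Suc 0) = 1"
| "chebyshev c (Suc (Suc n)) = 2 * c * chebyshev c (Suc n) - chebyshev c n"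

lemma chebyshev_cos: "chebyshev (cos x) n * sin x = sin (n * x)"
proof (induction "cos x" n rule: chebyshev.induct)
  case (3 n)
  have "sin (real (Suc (Suc n)) * x) + sin (real n * x) = 2 * cos x * sin (real (Suc n) * x)"
    using sin_add[of "Suc n * x" x] sin_diff[of "Suc n * x" x]
    by (simp add: algebra_simps)
  then show ?case
    using 3 by (simp add: algebra_simps)
qed auto

lemma chebyshev_one: "chebyshev 1 n = n"
  by (induction "1::real" n rule: chebyshev.induct) auto

text \<open>
  The root of the \<open>(n + 1)\<close>-st reflection met along the alternating word \<open>s t s \<dots>\<close>.
\<close>

definition dihedral_root :: "'v \<Rightarrow> 'v \<Rightarrow> nat \<Rightarrow> 'v vec" where
  "dihedral_root s t n = lincomb (chebyshev (- gram s t) (Suc n)) (simple_root s)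
     (chebyshev (- gram s t) n) (simple_root t)"

lemma refls_alternating_next:
  assumes "s \<in> V" "t \<in> V" "s \<noteq> t"
  shows "refls (alternating s t n) (simple_root (if even n then s else t)) = dihedral_root s t n"
  using assms
proof (induction n arbitrary: s t)
  case 0
  then show ?case by (auto simp: dihedral_root_def lincomb_def)
next
  case (Suc n)
  have "refls (alternating s t (Suc n)) (simple_root (if even (Suc n) then s else t)) =
    reflect s (dihedral_root t s n)"
    using Suc.IH[of t s] Suc.prems by auto
  also have "\<dots> = dihedral_root s t (Suc n)"
    using Suc.prems
    by (auto simp: reflect_eq_lincomb dihedral_root_def pairing_lincomb gram_commute[of t s])
       (auto simp: lincomb_def simple_root_def fun_eq_iff)
  finally show ?case .
qed

lemma sin_label_pos: "e \<in> E \<Longrightarrow> 0 < sin (pi / m e)"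
  using label_ge_2[of e] by (intro sin_gt_zero) (auto simp: field_simps)

lemma chebyshev_edge:
  assumes "{s, t} \<in> E"
  shows "chebyshev (- gram s t) n = sin (n * (pi / m {s, t})) / sin (pi / m {s, t})"
  using chebyshev_cos[of "pi / m {s, t}" n] sin_label_pos[OF assms]
  by (simp add: gram_edge[OF assms] field_simps)

text \<open>
  All multiples \<open>n \<pi> / m\<close> with \<open>n \<le> m\<close> lie in \<open>[0, \<pi>]\<close>: up to the length of the braid relation,
  the roots met along an alternating word are nonnegative.
\<close>

lemma chebyshev_edge_nonneg:
  assumes e: "{s, t} \<in> E" and n: "n \<le> m {s, t}"
  shows "0 \<le> chebyshev (- gram s t) n"
proof -
  have "real n * (pi / m {s, t}) \<le> pi"
    using n label_ge_2[OF e] by (simp add: field_simps)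
  then show ?thesis
    using sin_label_pos[OF e] by (simp add: chebyshev_edge[OF e] sin_ge_zero)
qed

lemma chebyshev_edge_symmetric:
  assumes e: "{s, t} \<in> E" and n: "n \<le> m {s, t}"
  shows "chebyshev (- gram s t) (m {s, t} - n) = chebyshev (- gram s t) n"
proof -
  have "real (m {s, t} - n) * (pi / m {s, t}) = pi - n * (pi / m {s, t})"
    using n label_ge_2[OF e] by (simp add: of_nat_diff field_simps)
  then show ?thesis
    by (simp add: chebyshev_edge[OF e])
qed

text \<open>
  The two alternating words of length \<open>m {s, t}\<close> meet the same roots in opposite orders; this
  is the symmetry \<open>sin (\<pi> - x) = sin x\<close>.
\<close>

lemma dihedral_root_commute:
  assumes e: "{s, t} \<in> E" and n: "n < m {s, t}"
  shows "dihedral_root s t n = dihedral_root t s (m {s, t} - Suc n)"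
  using chebyshev_edge_symmetric[OF e, of n] chebyshev_edge_symmetric[OF e, of "Suc n"] n
  by (auto simp: dihedral_root_def gram_commute[of t s] lincomb_def Suc_diff_Suc)

lemma dihedral_roots_commute:
  assumes e: "{s, t} \<in> E" and "\<exists>i < m {s, t}. q = dihedral_root s t i"
  shows "\<exists>i < m {s, t}. q = dihedral_root t s i"
proof -
  obtain i where "i < m {s, t}" "q = dihedral_root s t i" using assms(2) by blast
  moreover from this have "m {s, t} - Suc i < m {s, t}" by simp
  ultimately show ?thesis
    using dihedral_root_commute[OF e, of i] by metis
qed

lemma chebyshev_edge_Suc:
  assumes e: "{s, t} \<in> E"
  shows "chebyshev (- gram s t) (Suc (m {s, t})) = - 1"
proof -
  have "real (Suc (m {s, t})) * (pi / m {s, t}) = pi / m {s, t} + pi"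
    using label_ge_2[OF e] by (simp add: field_simps)
  then show ?thesis
    using sin_label_pos[OF e] by (simp add: chebyshev_edge[OF e])
qed

lemma dihedral_root_label:
  assumes e: "{s, t} \<in> E"
  shows "dihedral_root s t (m {s, t}) = lincomb (- 1) (simple_root s) 0 (simple_root t)"
  using chebyshev_edge_Suc[OF e] chebyshev_edge_symmetric[OF e, of 0]
  by (simp add: dihedral_root_def)

lemma braid_on_roots:
  assumes e: "{s, t} \<in> E" 
  shows "refls (alternating s t (m {s, t})) (simple_root (if even (m {s, t}) then s else t)) =
         refls (alternating t s (m {s, t})) (simple_root (if even (m {s, t}) then s else t))"
proof -
  have V: "s \<in> V" "t \<in> V" "s \<noteq> t"
    using edges[OF e] edge_distinct[OF e] by auto
  obtain k where k: "m {s, t} = Suc k"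
    using label_ge_2[OF e] by (cases "m {s, t}") auto
  have "refls (alternating t s (Suc k)) (simple_root (if even (Suc k) then s else t)) =
    lincomb (- 1) (dihedral_root t s k) 0 (simple_root t)"
    using refls_alternating_next[of t s k] V
    unfolding alternating_Suc_right
    by (auto simp: refls_neg_reflect[where q = "simple_root t"])
  also have "dihedral_root t s k = dihedral_root s t 0"
    using dihedral_root_commute[OF e, of 0] k by simp
  also have "lincomb (- 1) (dihedral_root s t 0) 0 (simple_root t) = dihedral_root s t (m {s, t})"
    unfolding dihedral_root_label[OF e] by (auto simp: dihedral_root_def lincomb_def)
  finally show ?thesis
    using refls_alternating_next[of s t "m {s, t}"] V k by simp
qed

lemma refls_fixed:
  assumes "set ws \<subseteq> {s, t}" "pairing s p = 0" "pairing t p = 0"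
  shows "refls ws p = p"
  using assms by (induction ws) (auto simp: reflect_def)

lemma gram_edge_abs:
  assumes e: "{s, t} \<in> E"
  shows "(gram s t)\<^sup>2 \<noteq> 1"
proof -
  have "(gram s t)\<^sup>2 = 1 - (sin (pi / m {s, t}))\<^sup>2"
    by (simp add: gram_edge[OF e] cos_squared_eq)
  then show ?thesis
    using sin_label_pos[OF e] by simp
qed

lemma label_angle:
  assumes "e \<in> E" shows "0 \<le> pi / m e" "pi / m e \<le> pi"
  using label_ge_2[OF assms] by (simp_all add: field_simps)

text \<open>
  The cosine is injective on \<open>[0, \<pi>]\<close>, and only non-adjacent vertices have Gram entry \<open>- 1\<close>.
  This is how isometries of the geometric representation preserve edges and labels.
\<close>

lemma gram_determines_label:
  assumes e: "{s, t} \<in> E" and "y \<noteq> z" and eq: "gram y z = gram s t"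
  shows "{y, z} \<in> E \<and> m {y, z} = m {s, t}"
proof
  show e': "{y, z} \<in> E"
    using gram_edge_abs[OF e] assms(2) unfolding eq[symmetric]
    by (simp add: gram_def split: if_splits)
  have "cos (pi / m {y, z}) = cos (pi / m {s, t})"
    using eq by (simp add: gram_edge[OF e] gram_edge[OF e'])
  then have "pi / m {y, z} = pi / m {s, t}"
    using cos_inj_pi[OF label_angle[OF e'] label_angle[OF e]] by blast
  then show "m {y, z} = m {s, t}"
    using label_ge_2[OF e] by simp
qed

lemma set_alternating: "set (alternating s t n) \<subseteq> {s, t}"
  by (induction n arbitrary: s t) auto

text \<open>
  Both sides agree on \<open>\<alpha>\<^sub>s\<close> and \<open>\<alpha>\<^sub>t\<close> and fix the vectors orthogonal to these two.  The form is
  nondegenerate on the plane of \<open>\<alpha>\<^sub>s\<close> and \<open>\<alpha>\<^sub>t\<close> because its Gram determinant is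
  \<open>sin\<^sup>2 (\<pi> / m)\<close>, so plane and orthogonal complement span everything.
\<close>

lemma braid_refls:
  assumes e: "{s, t} \<in> E" 
  shows "refls (alternating s t (m {s, t})) = refls (alternating t s (m {s, t}))"
    (is "refls ?d = refls ?d'")
proof
  fix p
  have V: "s \<in> V" "t \<in> V" "s \<noteq> t"
    using edges[OF e] edge_distinct[OF e] by auto
  let ?g = "gram s t"
  \<comment> \<open>Cramer's rule for the orthogonal projection of p to the plane.\<close>
  define D where "D = 1 - ?g\<^sup>2"
  define a where "a = (pairing s p - ?g * pairing t p) / D"
  define b where "b = (pairing t p - ?g * pairing s p) / D"
  define q where "q = lincomb 1 p (- 1) (lincomb a (simple_root s) b (simple_root t))"
  have D: "D \<noteq> 0"
    using gram_edge_abs[OF e] by (simp add: D_def)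
  have "a + b * ?g = (pairing s p * (1 - ?g\<^sup>2)) / D"
    by (simp add: a_def b_def add_divide_distrib[symmetric]) (simp add: algebra_simps power2_eq_square)
  then have 1: "a + b * ?g = pairing s p"
    using D by (simp add: D_def)
  have "a * ?g + b = (pairing t p * (1 - ?g\<^sup>2)) / D"
    by (simp add: a_def b_def add_divide_distrib[symmetric]) (simp add: algebra_simps power2_eq_square)
  then have 2: "a * ?g + b = pairing t p"
    using D by (simp add: D_def)
  have q: "pairing s q = 0" "pairing t q = 0"
    using 1 2 V by (auto simp: q_def pairing_lincomb gram_commute[of t s])
  have p: "p = lincomb 1 q 1 (lincomb a (simple_root s) b (simple_root t))"
    by (auto simp: q_def lincomb_def)
  have e': "{t, s} \<in> E" using e by (simp add: insert_commute)
  have "refls ?d (simple_root s) = refls ?d' (simple_root s) \<and>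
        refls ?d (simple_root t) = refls ?d' (simple_root t)"
    using braid_on_roots[OF e] braid_on_roots[OF e'] 
    by (cases "even (m {s, t})") (auto simp: insert_commute)
  moreover have "refls ?d q = q" "refls ?d' q = q"
    using q set_alternating[of s t] set_alternating[of t s]
    by (auto intro!: refls_fixed[of _ s t])
  ultimately show "refls ?d p = refls ?d' p"
    by (subst (1 2) p) (simp add: refls_lincomb)
qed


section \<open>Every root is nonnegative or nonpositive\<close>

text \<open>
  A word longer than the braid relation can be shortened by two: apply the relation after the
  first letter, \<open>s t s t \<dots> = s (t s t \<dots>) = s (s t s \<dots>)\<close>, and cancel.
\<close>

lemma alternating_reduces:
  assumes e: "{s, t} \<in> E" and n: "m {s, t} \<le> n"
  obtains d where "d \<in> lists {s, t}" "length d < n" "refls d = refls (alternating s t (Suc n))"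
proof -
  have V: "s \<in> V" "t \<in> V"
    using edges[OF e] by auto
  have e': "{t, s} \<in> E" using e by (simp add: insert_commute)
  obtain k where k: "m {s, t} = Suc k"
    using label_ge_2[OF e] by (cases "m {s, t}") auto
  define r where "r = drop (Suc (Suc k)) (alternating s t (Suc n))"
  have "alternating s t (Suc n) = alternating s t (Suc (Suc k)) @ r"
    using n k append_take_drop_id[of "Suc (Suc k)" "alternating s t (Suc n)"]
    by (simp only: r_def take_alternating Suc_le_mono)
  then have "refls (alternating s t (Suc n)) = reflect s \<circ> refls (alternating t s (Suc k)) \<circ> refls r"
    by (auto simp: fun_eq_iff)
  also have "refls (alternating t s (Suc k)) = refls (alternating s t (Suc k))"
    using braid_refls[OF e'] k by (simp add: insert_commute)
  also have "reflect s \<circ> refls (alternating s t (Suc k)) \<circ> refls r = refls (alternating t s k @ r)"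
    using V by (auto simp: fun_eq_iff)
  finally have 1: "refls (alternating t s k @ r) = refls (alternating s t (Suc n))" ..
  have "alternating s t (Suc n) \<in> lists {s, t}"
    by (rule alternating_in_lists) auto
  then have "r \<in> lists {s, t}"
    unfolding r_def by (auto dest: in_set_dropD)
  moreover have "alternating t s k \<in> lists {s, t}"
    by (rule alternating_in_lists) auto
  moreover have "length r = n - Suc k"
    by (simp add: r_def)
  ultimately show thesis
    using that[of "alternating t s k @ r"] 1 n k by auto
qed

lemma dihedral_word_cases:
  assumes "d \<in> lists {s, t}" "s \<in> V" "t \<in> V"
  obtains "d = alternating s t (length d)" | "d = alternating t s (length d)"
  | d' where "d' \<in> lists {s, t}" "length d' < length d" "refls d' = refls d"
proof -
  have "d = alternating s t (length d) \<or> d = alternating t s (length d) \<or>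
    (\<exists>d'\<in>lists {s, t}. length d' < length d \<and> refls d' = refls d)"
    using assms
  proof (induction d rule: list.induct)
    case (Cons x d)
    consider "d = alternating s t (length d)" | "d = alternating t s (length d)"
      | d' where "d' \<in> lists {s, t}" "length d' < length d" "refls d' = refls d"
      using Cons by auto
    then show ?case
    proof cases
      case 3
      moreover have "x \<in> {s, t}" using Cons.prems(1) by simp
      ultimately show ?thesis
        by (intro disjI2 bexI[of _ "x # d'"]) auto
    next
      case 1
      show ?thesis
      proof (cases d)
        case Nil
        then show ?thesis using Cons.prems by auto
      next
        case (Cons y d')
        then have y: "y = s" using 1 by auto
        show ?thesis
        proof (cases "x = s")
          case True
          then show ?thesis
            using Cons.prems Cons y by (intro disjI2 bexI[of _ d']) (auto simp: fun_eq_iff)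
        next
          case False
          then have "x = t" using Cons.prems by auto
          then show ?thesis using 1 by auto
        qed
      qed
    next
      case 2
      show ?thesis
      proof (cases d)
        case Nil
        then show ?thesis using Cons.prems by auto
      next
        case (Cons y d')
        then have y: "y = t" using 2 by auto
        show ?thesis
        proof (cases "x = t")
          case True
          then show ?thesis
            using Cons.prems Cons y by (intro disjI2 bexI[of _ d']) (auto simp: fun_eq_iff)
        next
          case False
          then have "x = s" using Cons.prems by auto
          then show ?thesis using 2 by auto
        qed
      qed
    qed
  qed auto
  then show thesis using that by blast
qed

text \<open>
  The rank two case of the positivity theorem.  Minimality makes \<open>d\<close> an alternating word that
  does not end in \<open>s\<close> and that is shorter than the braid relation, and then \<open>d \<alpha>\<^sub>s\<close> is an
  explicit dihedral root.
\<close>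

lemma dihedral_nonneg:
  assumes d: "d \<in> lists {s, t}" and st: "s \<in> V" "t \<in> V" "s \<noteq> t"
    and min: "\<And>d'. d' \<in> lists {s, t} \<Longrightarrow> refls d' = refls d \<Longrightarrow> length d \<le> length d'"
    and min_s: "\<And>d'. d' \<in> lists {s, t} \<Longrightarrow> refls d' = refls (d @ [s]) \<Longrightarrow> length d \<le> length d'"
  shows "\<exists>a b. 0 \<le> a \<and> 0 \<le> b \<and> refls d (simple_root s) = lincomb a (simple_root s) b (simple_root t)"
proof -
  define n where "n = length d"
  obtain p q where pq: "d = alternating p q n" "{p, q} = {s, t}" "n = 0 \<longrightarrow> p = s"
  proof (cases "n = 0")
    case True
    then show thesis using that[of s t] by (simp add: n_def)
  next
    case False
    have "d = alternating s t n \<or> d = alternating t s n"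
    proof (cases rule: dihedral_word_cases[OF d st(1,2)])
      case (3 d')
      then show ?thesis using min[of d'] by simp
    qed (simp_all add: n_def)
    then show thesis using that[of s t] that[of t s] False by auto
  qed
  have pqV: "p \<in> V" "q \<in> V" "p \<noteq> q"
    using pq st by (metis doubleton_eq_iff)+
  \<comment> \<open>That is, s is the letter that continues the alternating word d.\<close>
  have nxt: "(if even n then p else q) = s"
  proof (rule ccontr)
    assume neq: "(if even n then p else q) \<noteq> s"
    show False
    proof (cases n)
      case (Suc k)
      have "(if even k then p else q) = s"
        using neq pq Suc by (auto simp: doubleton_eq_iff split: if_splits)
      then have "d @ [s] = alternating p q k @ [s, s]"
        using pq Suc alternating_Suc_right[of p q k] by simp
      then have "refls (alternating p q k) = refls (d @ [s])"
        using st by (auto simp: fun_eq_iff)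
      moreover have "alternating p q k \<in> lists {s, t}"
        using pq by (intro alternating_in_lists) auto
      ultimately show False
        using min_s[of "alternating p q k"] Suc by (simp add: n_def)
    next
      case 0
      then show False using neq pq by simp
    qed
  qed
  have ds: "d @ [s] = alternating p q (Suc n)"
    using pq nxt by (simp only: alternating_Suc_right)
  have lt: "n < m {p, q}" if e: "{p, q} \<in> E"
  proof (rule ccontr)
    assume "\<not> n < m {p, q}"
    then have "m {p, q} \<le> n" by simp
    then obtain d' where "d' \<in> lists {p, q}" "length d' < n" "refls d' = refls (alternating p q (Suc n))"
      by (rule alternating_reduces[OF e])
    then have "d' \<in> lists {s, t}" "refls d' = refls (d @ [s])" "length d' < n"
      by (simp_all only: pq(2) ds)
    then show False
      using min_s[of d'] by (simp add: n_def)
  qed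
  have ge: "0 \<le> chebyshev (- gram p q) k" if "k \<le> Suc n" for k
  proof (cases "{p, q} \<in> E")
    case True
    then show ?thesis
      using chebyshev_edge_nonneg[OF True, of k] lt that by auto
  next
    case False
    then have "gram p q = - 1" using pqV by (simp add: gram_def)
    then show ?thesis by (simp add: chebyshev_one)
  qed
  have "refls d (simple_root s) = dihedral_root p q n"
    using refls_alternating_next[OF pqV, of n] nxt pq by simp
  then have *: "refls d (simple_root s) = lincomb (chebyshev (- gram p q) (Suc n)) (simple_root p)
     (chebyshev (- gram p q) n) (simple_root q)"
    by (simp add: dihedral_root_def)
  consider "p = s" "q = t" | "p = t" "q = s"
    using pq by (auto simp: doubleton_eq_iff)
  then show ?thesis
  proof cases
    case 1
    then show ?thesis using * ge[of n] ge[of "Suc n"] by auto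
  next
    case 2
    have "refls d (simple_root s) = lincomb (chebyshev (- gram p q) n) (simple_root s)
     (chebyshev (- gram p q) (Suc n)) (simple_root t)"
      unfolding * 2 by (auto simp: lincomb_def)
    then show ?thesis using ge[of n] ge[of "Suc n"] by auto
  qed
qed

text \<open>
  The positivity theorem for reflection groups: if appending \<open>s\<close> does not decrease the length,
  then \<open>\<alpha>\<^sub>s\<close> is sent to a nonnegative vector.  Let \<open>t\<close> be the last letter of a shortest word,
  and among all shortest words choose one with the longest final factor \<open>d\<close> over \<open>{s, t}\<close>.  The
  first factor is then shorter and satisfies the length hypothesis for both \<open>s\<close> and \<open>t\<close>, so by
  induction it sends both simple roots to nonnegative vectors; the factor \<open>d\<close> sends \<open>\<alpha>\<^sub>s\<close> to a
  nonnegative combination of \<open>\<alpha>\<^sub>s\<close> and \<open>\<alpha>\<^sub>t\<close> by the rank two case.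

  Lengths are compared through words with the same action.  The comparison is non-strict, so
  that for every \<open>w\<close> at least one of \<open>w\<close> and \<open>w s\<close> satisfies the hypotheses.
\<close>

lemma root_nonneg:
  assumes "ws \<in> lists V" "s \<in> V"
    and "\<And>ws'. ws' \<in> lists V \<Longrightarrow> refls ws' = refls ws \<Longrightarrow> length ws \<le> length ws'"
    and "\<And>ws'. ws' \<in> lists V \<Longrightarrow> refls ws' = refls (ws @ [s]) \<Longrightarrow> length ws \<le> length ws'"
  shows "nonneg (refls ws (simple_root s))"
  using assms
proof (induction ws arbitrary: s rule: measure_induct_rule[of length])
  case (less ws)
  note ws = less(2) and s = less(3) and min = less(4) and min_s = less(5)
  show ?case
  proof (cases ws rule: rev_cases)
    case Nil
    then show ?thesis by simp
  next
    case (snoc ws0 t)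
    have t: "t \<in> V" "ws0 \<in> lists V" using snoc ws by auto
    have st: "s \<noteq> t"
    proof
      assume "s = t"
      then have "refls ws0 = refls (ws @ [s])"
        using s snoc by (auto simp: fun_eq_iff)
      from min_s[OF t(2) this] show False using snoc by simp
    qed
    define P where "P = (\<lambda>(u, d). u \<in> lists V \<and> d \<in> lists {s, t} \<and> refls (u @ d) = refls ws \<and>
      length u + length d \<le> length ws)"
    have "P (ws0, [t])"
      using snoc t by (simp add: P_def)
    then obtain ud where ud: "P ud" "\<And>ud'. P ud' \<Longrightarrow> length (fst ud) \<le> length (fst ud')"
      using ex_has_least_nat[of P "(ws0, [t])" "\<lambda>ud. length (fst ud)"] by blast
    obtain u d where [simp]: "ud = (u, d)" by (cases ud)
    have u: "u \<in> lists V" and d: "d \<in> lists {s, t}" and eq: "refls (u @ d) = refls ws"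
      and len: "length u + length d \<le> length ws"
      using ud(1) by (auto simp: P_def)
    have least: "length u \<le> length u'" if "P (u', d')" for u' d'
      using ud(2)[OF that] by simp
    have dV: "d' \<in> lists V" if "d' \<in> lists {s, t}" for d'
      using that s t by auto
    have eq': "refls ws = refls u \<circ> refls d"
      using eq by (auto simp: fun_eq_iff)
    have shorter: "length u < length ws"
      using least[of ws0 "[t]"] \<open>P (ws0, [t])\<close> snoc by simp
    have min_u: "length u \<le> length u'" if "u' \<in> lists V" "refls u' = refls u" for u'
    proof -
      have "refls (u' @ d) = refls ws"
        using that eq by (auto simp: fun_eq_iff)
      then have "length ws \<le> length (u' @ d)"
        by (rule min[rotated]) (use that dV[OF d] in simp)
      then show ?thesis using len by simp
    qed
    \<comment> \<open>Otherwise r could be moved from the first factor to d, which would shorten the first factor.\<close>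
    have min_ur: "length u \<le> length u'"
      if u': "u' \<in> lists V" "refls u' = refls (u @ [r])" and r: "r \<in> {s, t}" for u' r
    proof (rule ccontr)
      assume "\<not> length u \<le> length u'"
      then have lt: "length u' < length u" by simp
      have "refls (u' @ r # d) = refls ws"
        using u' eq' r s t by (auto simp: fun_eq_iff)
      moreover have "r # d \<in> lists {s, t}" using d r by auto
      ultimately have "P (u', r # d)"
        using lt len u' by (simp add: P_def)
      then show False using least lt by fastforce
    qed
    have "nonneg (refls u (simple_root r))" if r: "r \<in> {s, t}" for r
    proof (rule less.IH[OF shorter u])
      show "r \<in> V" using r s t(1) by auto
    qed (use min_u min_ur r in blast)+
    then have pos: "nonneg (refls u (simple_root s))" "nonneg (refls u (simple_root t))"
      by auto
    have "\<exists>a b. 0 \<le> a \<and> 0 \<le> b \<and> refls d (simple_root s) = lincomb a (simple_root s) b (simple_root t)"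
    proof (rule dihedral_nonneg[OF d s t(1) st])
      fix d' assume d': "d' \<in> lists {s, t}"
      {
        assume "refls d' = refls d"
        then have "refls (u @ d') = refls ws"
          by (intro ext) (simp add: eq')
        then have "length ws \<le> length (u @ d')"
          by (rule min[rotated]) (use u dV[OF d'] in simp)
        then show "length d \<le> length d'" using len by simp
      next
        assume "refls d' = refls (d @ [s])"
        then have "refls (u @ d') = refls (ws @ [s])"
          by (intro ext) (simp add: eq')
        then have "length ws \<le> length (u @ d')"
          by (rule min_s[rotated]) (use u dV[OF d'] in simp)
        then show "length d \<le> length d'" using len by simp
      }
    qed
    then obtain a b where "0 \<le> a" "0 \<le> b"
      "refls d (simple_root s) = lincomb a (simple_root s) b (simple_root t)" by blast
    then show ?thesis
      using pos eq' by (simp add: refls_lincomb) (simp add: lincomb_def nonneg_def)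
  qed
qed

lemma root_sign:
  assumes "ws \<in> lists V" "s \<in> V"
  shows "nonneg (refls ws (simple_root s)) \<or> nonpos (refls ws (simple_root s))"
proof -
  have reduced: "\<exists>v\<in>lists V. refls v = refls u \<and>
      (\<forall>v'\<in>lists V. refls v' = refls u \<longrightarrow> length v \<le> length v')" if "u \<in> lists V" for u
    using ex_has_least_nat[of "\<lambda>v. v \<in> lists V \<and> refls v = refls u" u length] that by blast
  obtain v where v: "v \<in> lists V" "refls v = refls ws"
    "\<And>v'. v' \<in> lists V \<Longrightarrow> refls v' = refls ws \<Longrightarrow> length v \<le> length v'"
    using reduced[OF assms(1)] by blast
  have "ws @ [s] \<in> lists V" using assms by simp
  then obtain v' where v': "v' \<in> lists V" "refls v' = refls (ws @ [s])"
    "\<And>v''. v'' \<in> lists V \<Longrightarrow> refls v'' = refls (ws @ [s]) \<Longrightarrow> length v' \<le> length v''"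
    using reduced[of "ws @ [s]"] by blast
  have vs: "refls (v @ [s]) = refls (ws @ [s])" "refls (v' @ [s]) = refls ws"
    using v v' assms by (auto simp: fun_eq_iff)
  show ?thesis
  proof (cases "length v \<le> length v'")
    case True
    have "nonneg (refls v (simple_root s))"
    proof (rule root_nonneg[OF v(1) assms(2)])
      fix u assume u: "u \<in> lists V"
      show "length v \<le> length u" if "refls u = refls v"
        using v(3)[OF u] that v(2) by simp
      show "length v \<le> length u" if "refls u = refls (v @ [s])"
        using v'(3)[OF u] that vs(1) True by simp
    qed
    then show ?thesis using v by simp
  next
    case False
    have "nonneg (refls v' (simple_root s))"
    proof (rule root_nonneg[OF v'(1) assms(2)])
      fix u assume u: "u \<in> lists V"
      show "length v' \<le> length u" if "refls u = refls v'"
        using v'(3)[OF u] that v'(2) by simp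
      show "length v' \<le> length u" if "refls u = refls (v' @ [s])"
        using v(3)[OF u] that vs(2) False by simp
    qed
    moreover have "refls v' (simple_root s) = lincomb (- 1) (refls ws (simple_root s)) 0 (simple_root s)"
      using v'(2) refls_neg_reflect[of s ws "simple_root s"] assms by simp
    ultimately show ?thesis by (auto simp: nonneg_def nonpos_def lincomb_def)
  qed
qed


definition refl_group :: "('v vec \<Rightarrow> 'v vec) set" where
  "refl_group = refls ` lists V"

lemma id_in_refl_group: "id \<in> refl_group"
  unfolding refl_group_def by (rule image_eqI[of _ _ "[]"]) (auto simp: fun_eq_iff)

lemma refl_group_reflect: "w \<in> refl_group \<Longrightarrow> s \<in> V \<Longrightarrow> w \<circ> reflect s \<in> refl_group"
proof -
  assume "w \<in> refl_group" and s: "s \<in> V"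
  then obtain ws where "w = refls ws" "ws \<in> lists V" by (auto simp: refl_group_def)
  then show ?thesis
    unfolding refl_group_def using s by (intro image_eqI[of _ _ "ws @ [s]"]) (auto simp: fun_eq_iff)
qed

lemma refl_group_lincomb: "w \<in> refl_group \<Longrightarrow> w (lincomb a p b q) = lincomb a (w p) b (w q)"
  by (auto simp: refl_group_def refls_lincomb)

lemma refl_group_form:
  assumes "w \<in> refl_group" shows "form (w p) (w q) = form p q"
proof -
  have "form (refls ws p) (refls ws q) = form p q" if "set ws \<subseteq> V" for ws
    using that by (induction ws) (auto simp: form_reflect)
  then show ?thesis using assms by (auto simp: refl_group_def lists_eq_set)
qed

lemma refl_group_inverse:
  assumes "w \<in> refl_group" obtains v where "v \<in> refl_group" "\<And>p. w (v p) = p" "\<And>p. v (w p) = p"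
proof -
  obtain ws where ws: "w = refls ws" "set ws \<subseteq> V" using assms by (auto simp: refl_group_def lists_eq_set)
  have 1: "refls us (refls (rev us) p) = p" if "set us \<subseteq> V" for us p
    using that by (induction us arbitrary: p) auto
  have "refls (rev ws) \<in> refl_group"
    unfolding refl_group_def using ws by (intro imageI) (auto simp: lists_eq_set)
  then show thesis
    using that 1[of ws] 1[of "rev ws"] ws by simp
qed

lemma refl_group_sign: "w \<in> refl_group \<Longrightarrow> s \<in> V \<Longrightarrow> nonneg (w (simple_root s)) \<or> nonpos (w (simple_root s))"
  using root_sign by (auto simp: refl_group_def)

lemma form_root: "w \<in> refl_group \<Longrightarrow> s \<in> V \<Longrightarrow> form (w (simple_root s)) (w (simple_root s)) = 1"
  by (simp add: refl_group_form)

text \<open>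
  Roots have norm one, so a simple root is the only nonnegative root on its coordinate axis.
\<close>

lemma unit_on_axis_eq_simple_root:
  assumes "nonneg p" "\<And>u. u \<noteq> s \<Longrightarrow> p u = 0" "form p p = 1" "s \<in> V"
  shows "p = simple_root s"
proof -
  define c where "c = p s"
  have p: "p = lincomb c (simple_root s) 0 (simple_root s)"
    using assms(2) by (auto simp: lincomb_def simple_root_def c_def)
  have "form (simple_root s) p = c"
    using assms(4) by (simp add: p pairing_lincomb)
  moreover have "form p p = c * form (simple_root s) p"
    by (subst (1) p) (simp add: form_lincomb_left)
  ultimately have "form p p = c * c" by simp
  then have "c\<^sup>2 = 1" using assms(3) by (simp add: power2_eq_square)
  then have "c = 1" using assms(1) by (auto simp: nonneg_def power2_eq_1_iff c_def dest: spec[of _ s])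
  then show ?thesis unfolding p by (simp add: lincomb_def)
qed

text \<open>
  A simple reflection \<open>s\<^sub>x\<close> changes only the coordinate at \<open>x\<close>.  If it made a nonnegative root
  nonpositive, all other coordinates would vanish, and the root would be \<open>\<alpha>\<^sub>x\<close>.
\<close>

lemma reflect_root_nonneg:
  assumes w: "w \<in> refl_group" "x \<in> V" and s: "s \<in> V" and p: "w (simple_root s) = p"
    and pos: "nonneg p" and ne: "p \<noteq> simple_root x"
  shows "nonneg (reflect x p)"
proof (rule ccontr)
  assume neg: "\<not> nonneg (reflect x p)"
  obtain ws where ws: "w = refls ws" "ws \<in> lists V" using w by (auto simp: refl_group_def)
  have "reflect x p = refls (x # ws) (simple_root s)"
    using ws p by simp
  then have "nonpos (reflect x p)"
    using root_sign[of "x # ws" s] ws s w neg by auto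
  then have "p u = 0" if "u \<noteq> x" for u
    using pos that by (simp add: nonpos_def nonneg_def reflect_def) (metis order_antisym)
  then show False
    using unit_on_axis_eq_simple_root[of p x] pos ne w form_root[OF w(1) s] p by simp
qed

text \<open>
  The conjugate of a reflection by an isometry is the reflection in the image of the root.
\<close>

lemma refl_group_intertwine:
  assumes "w \<in> refl_group" "s \<in> V" "x \<in> V" "w (simple_root s) = simple_root x"
  shows "w \<circ> reflect s = reflect x \<circ> w"
proof
  fix p
  have "pairing x (w p) = pairing s p"
    using refl_group_form[OF assms(1), of "simple_root s" p] assms(2,3) by (simp add: assms(4))
  then show "(w \<circ> reflect s) p = (reflect x \<circ> w) p"
    by (simp add: reflect_eq_lincomb refl_group_lincomb[OF assms(1)] assms(4))
qed

end

section \<open>The walk on right cosets of a standard parabolic subgroup\<close>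

locale artin_parabolic = artin_graph V E m
  for V :: "'v set" and E :: "'v set set" and m :: "'v set \<Rightarrow> nat" +
  fixes X :: "'v set"
  assumes X_subset: "X \<subseteq> V"
begin

sublocale P: group_presentation V "artin_relations E m"
  by (rule artin_presentation)

abbreviation word_eq (infix "\<approx>" 50) where
  "u \<approx> v \<equiv> pres_eq V (artin_relations E m) u v"

text \<open>
  The elements of minimal length in their right coset modulo the subgroup generated by the
  reflections \<open>s\<^sub>x\<close> with \<open>x \<in> X\<close>.  The condition says that \<open>w\<inverse> \<alpha>\<^sub>x\<close> is nonnegative, without
  mentioning the inverse.
\<close>

definition min_reps :: "('v vec \<Rightarrow> 'v vec) set" where
  "min_reps = {w \<in> refl_group. \<forall>x\<in>X. \<forall>p. w p = simple_root x \<longrightarrow> nonneg p}"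

definition stays :: "('v vec \<Rightarrow> 'v vec) \<Rightarrow> 'v \<Rightarrow> bool" where
  "stays w s \<longleftrightarrow> w (simple_root s) \<in> simple_root ` X"

text \<open>
  Meaningful only if the walk stays at \<open>w\<close> when it reads \<open>s\<close>: then \<open>w\<close> conjugates \<open>s\<^sub>s\<close> to the
  simple reflection of this vertex.
\<close>

definition target :: "('v vec \<Rightarrow> 'v vec) \<Rightarrow> 'v \<Rightarrow> 'v" where
  "target w s = (THE x. w (simple_root s) = simple_root x)"

fun endpoint :: "('v vec \<Rightarrow> 'v vec) \<Rightarrow> 'v word \<Rightarrow> 'v vec \<Rightarrow> 'v vec" where
  "endpoint w [] = w"
| "endpoint w ((s, b) # u) = endpoint (if stays w s then w else w \<circ> reflect s) u"

text \<open>
  Reflections are involutions, so a letter and its inverse make the same step; the sign matters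
  only for the letter that is written.
\<close>

fun retract :: "('v vec \<Rightarrow> 'v vec) \<Rightarrow> 'v word \<Rightarrow> 'v word" where
  "retract w [] = []"
| "retract w ((s, b) # u) =
    (if stays w s then (target w s, b) # retract w u else retract (w \<circ> reflect s) u)"

lemma stays_iff: "stays w s \<longleftrightarrow> (\<exists>x\<in>X. w (simple_root s) = simple_root x)"
  by (auto simp: stays_def)

lemma target_eq: "w (simple_root s) = simple_root x \<Longrightarrow> target w s = x"
  by (auto simp: target_def)

lemma target_in_X: "stays w s \<Longrightarrow> target w s \<in> X"
  by (auto simp: stays_iff target_eq)

lemma staysE:
  assumes "stays w s" obtains x where "x \<in> X" "w (simple_root s) = simple_root x" "target w s = x"
  using assms by (auto simp: stays_iff target_eq)

lemma endpoint_append: "endpoint w (u @ v) = endpoint (endpoint w u) v"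
proof (induction u arbitrary: w)
  case (Cons l u)
  then show ?case by (cases l) (simp del: o_apply)
qed simp

lemma retract_append: "retract w (u @ v) = retract w u @ retract (endpoint w u) v"
proof (induction u arbitrary: w)
  case (Cons l u)
  then show ?case by (cases l) (simp del: o_apply)
qed simp

lemma min_reps_in_refl_group: "w \<in> min_reps \<Longrightarrow> w \<in> refl_group"
  by (simp add: min_reps_def)

lemma min_reps_nonneg: "w \<in> min_reps \<Longrightarrow> x \<in> X \<Longrightarrow> w p = simple_root x \<Longrightarrow> nonneg p"
  by (simp add: min_reps_def)

lemma id_in_min_reps: "id \<in> min_reps"
  using id_in_refl_group by (auto simp: min_reps_def)

text \<open>
  Deodhar's lemma.  The root \<open>w\<inverse> \<alpha>\<^sub>x\<close> is nonnegative and differs from \<open>\<alpha>\<^sub>s\<close>, since the walk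
  does not stay; hence the reflection \<open>s\<^sub>s\<close> keeps it nonnegative.
\<close>

lemma min_reps_step:
  assumes w: "w \<in> min_reps" and s: "s \<in> V" and "\<not> stays w s"
  shows "w \<circ> reflect s \<in> min_reps"
proof -
  have "nonneg p" if x: "x \<in> X" and p: "w (reflect s p) = simple_root x" for x p
  proof -
    obtain v where v: "v \<in> refl_group" "\<And>p. v (w p) = p"
      using refl_group_inverse[OF min_reps_in_refl_group[OF w]] by metis
    have "v (simple_root x) = reflect s p" using v(2)[of "reflect s p"] p by simp
    moreover have "nonneg (reflect s p)" using min_reps_nonneg[OF w x p] .
    moreover have "reflect s p \<noteq> simple_root s"
      using assms(3) p x by (auto simp: stays_iff)
    ultimately have "nonneg (reflect s (reflect s p))"
      using reflect_root_nonneg[of v s x "reflect s p"] v(1) s x X_subset by auto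
    then show ?thesis using s by simp
  qed
  then show ?thesis
    using refl_group_reflect[OF min_reps_in_refl_group[OF w] s] by (auto simp: min_reps_def)
qed

lemma words_Cons: "(s, b) # u \<in> words S \<longleftrightarrow> s \<in> S \<and> u \<in> words S"
  by (auto simp: words_def)

lemma endpoint_in_min_reps: "w \<in> min_reps \<Longrightarrow> u \<in> words V \<Longrightarrow> endpoint w u \<in> min_reps"
proof (induction u arbitrary: w)
  case (Cons l u)
  then show ?case by (cases l) (simp add: words_Cons min_reps_step del: o_apply)
qed simp

lemma retract_words: "retract w u \<in> words X"
proof (induction u arbitrary: w)
  case (Cons l u)
  then show ?case by (cases l) (simp add: words_Cons target_in_X del: o_apply)
qed (simp add: words_def)

abbreviation rho :: "'v word \<Rightarrow> 'v vec \<Rightarrow> 'v vec" where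
  "rho u \<equiv> refls (map fst u)"

text \<open>
  Staying at \<open>w\<close> trades a factor \<open>s\<^sub>s\<close> on the right of \<open>w\<close> for the factor \<open>s\<^sub>x\<close> of the written
  letter on its left, and a move absorbs \<open>s\<^sub>s\<close> into the position.
\<close>

lemma refls_retract_endpoint:
  assumes "w \<in> min_reps" "u \<in> words V"
  shows "w (rho u p) = rho (retract w u) (endpoint w u p)"
  using assms
proof (induction u arbitrary: w)
  case (Cons l u)
  obtain s b where l: "l = (s, b)" by (cases l)
  have s: "s \<in> V" and u: "u \<in> words V" using Cons.prems(2) by (auto simp: l words_Cons)
  show ?case
  proof (cases "stays w s")
    case True
    then obtain x where x: "x \<in> X" "w (simple_root s) = simple_root x" "target w s = x"
      by (rule staysE)
    have "w (reflect s (rho u p)) = reflect x (w (rho u p))"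
      using fun_cong[OF refl_group_intertwine[OF min_reps_in_refl_group[OF Cons.prems(1)] s _ x(2)]] x(1) X_subset by auto
    then show ?thesis using Cons.IH[OF Cons.prems(1) u] True x by (simp add: l)
  next
    case False
    have "w (rho (l # u) p) = (w \<circ> reflect s) (rho u p)"
      by (simp add: l)
    also have "\<dots> = rho (retract (w \<circ> reflect s) u) (endpoint (w \<circ> reflect s) u p)"
      by (rule Cons.IH[OF min_reps_step[OF Cons.prems(1) s False] u])
    finally show ?thesis using False by (simp add: l del: o_apply)
  qed
qed simp

lemma Prod_Suc_right: "Prod s t (Suc n) = Prod s t n @ [(if even n then s else t, True)]"
  unfolding Prod_eq_map_alternating alternating_Suc_right by simp

lemma Prod_words: "s \<in> S \<Longrightarrow> t \<in> S \<Longrightarrow> Prod s t n \<in> words S"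
  by (induction n arbitrary: s t) (auto simp: words_def)

text \<open>
  The vector \<open>q\<close> is the only one in the plane of \<open>\<alpha>\<^sub>s\<close> and \<open>\<alpha>\<^sub>t\<close> that \<open>w\<close> may send to a simple
  root from \<open>X\<close>, namely to \<open>\<alpha>\<^sub>x\<close>.  The walk along \<open>s t s \<dots>\<close> moves freely until it meets the
  root \<open>q\<close>, where it stays once and writes \<open>x\<close>.  From then on its position is the free one
  multiplied on the left by \<open>s\<^sub>x\<close>.  To stay a second time, it would have to meet the root
  \<open>- q\<close>, but up to the length of the braid relation all roots met are nonnegative.
\<close>

lemma alternating_walk_one_loop:
  assumes e: "{s, t} \<in> E" and w: "w \<in> min_reps" and n: "n \<le> m {s, t}"
    and uniq: "\<And>x' a b. x' \<in> X \<Longrightarrow> w (lincomb a (simple_root s) b (simple_root t)) = simple_root x' \<Longrightarrow>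
      x' = x \<and> lincomb a (simple_root s) b (simple_root t) = q"
  defines "hit \<equiv> \<lambda>n. x \<in> X \<and> w q = simple_root x \<and> (\<exists>i<n. q = dihedral_root s t i)"
  shows "retract w (Prod s t n) = (if hit n then [(x, True)] else []) \<and>
    endpoint w (Prod s t n) = (if hit n then reflect x \<circ> w \<circ> refls (alternating s t n)
                           else w \<circ> refls (alternating s t n))"
  using n
proof (induction n)
  case 0
  then show ?case by (auto simp: hit_def)
next
  case (Suc n)
  have V: "s \<in> V" "t \<in> V" "s \<noteq> t"
    using edges[OF e] edge_distinct[OF e] by auto
  have wW: "w \<in> refl_group" using w by (rule min_reps_in_refl_group)
  define r where "r = (if even n then s else t)"
  have r: "r \<in> V" using V by (simp add: r_def)
  have alt: "refls (alternating s t (Suc n)) = refls (alternating s t n) \<circ> reflect r"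
    unfolding alternating_Suc_right by (auto simp: r_def)
  have P: "Prod s t (Suc n) = Prod s t n @ [(r, True)]"
    unfolding Prod_Suc_right r_def ..
  define b where "b = dihedral_root s t n"
  have b: "refls (alternating s t n) (simple_root r) = b"
    using refls_alternating_next[OF V] by (simp add: r_def b_def)
  have hit_Suc: "hit (Suc n) \<longleftrightarrow> hit n \<or> (x \<in> X \<and> w q = simple_root x \<and> q = b)"
    by (auto simp: hit_def less_Suc_eq b_def)
  have pos: "nonneg (dihedral_root s t i)" if "i \<le> n" for i
    using chebyshev_edge_nonneg[OF e, of i] chebyshev_edge_nonneg[OF e, of "Suc i"] that Suc.prems
    by (simp add: dihedral_root_def lincomb_def nonneg_def simple_root_def)
  obtain b1 b2 where b12: "b = lincomb b1 (simple_root s) b2 (simple_root t)"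
    by (auto simp: b_def dihedral_root_def)
  show ?case
  proof (cases "hit n")
    case True
    then have x: "x \<in> X" "w q = simple_root x" and q: "nonneg q" 
      using pos by (auto simp: hit_def)
    obtain q1 q2 where q12: "q = lincomb q1 (simple_root s) q2 (simple_root t)"
      using True by (auto simp: hit_def dihedral_root_def)
    have xV: "x \<in> V" using x X_subset by auto
    let ?w = "reflect x \<circ> w \<circ> refls (alternating s t n)"
    have IH: "retract w (Prod s t n) = [(x, True)]" "endpoint w (Prod s t n) = ?w"
      using Suc True by auto
    \<comment> \<open>The simple root reached would again come from the plane, hence be that of x itself.\<close>
    have "\<not> stays ?w r"
    proof
      assume "stays ?w r"
      then obtain x' where x': "x' \<in> X" "reflect x (w b) = simple_root x'"
        by (auto simp: stays_iff b)
      have x'V: "x' \<in> V" using x' X_subset by auto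
      have "w b = reflect x (simple_root x')"
        using x' xV by (metis reflect_reflect)
      then have "w (lincomb 1 b (2 * gram x x') q) = simple_root x'"
        using x' x x'V by (simp add: refl_group_lincomb[OF wW] reflect_eq_lincomb) (simp add: lincomb_def)
      moreover have lc: "lincomb 1 b (2 * gram x x') q =
        lincomb (b1 + 2 * gram x x' * q1) (simple_root s) (b2 + 2 * gram x x' * q2) (simple_root t)"
        unfolding b12 q12 by (auto simp: lincomb_def algebra_simps)
      ultimately have "x' = x \<and> lincomb 1 b (2 * gram x x') q = q"
        using uniq[OF x'(1)] by simp
      then have "lincomb 1 b 2 q = q" by auto
      then have "b u + 2 * q u = q u" for u
        by (auto simp: lincomb_def dest: fun_cong[of _ _ u])
      moreover have "0 \<le> b u" "0 \<le> q u" for u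
        using pos[of n] q by (auto simp: nonneg_def b_def)
      ultimately have "q u = 0" for u
        by (smt (verit))
      then have "q = lincomb 0 q 0 q"
        by (auto simp: lincomb_def)
      then have "simple_root x = lincomb 0 (w q) 0 (w q)"
        using x refl_group_lincomb[OF wW, of 0 q 0 q] by metis
      then show False
        by (auto simp: lincomb_def simple_root_def dest: fun_cong[of _ _ x])
    qed
    then show ?thesis
      using IH True hit_Suc by (simp add: P retract_append endpoint_append alt o_assoc del: Prod.simps alternating.simps o_apply)
  next
    case False
    let ?w = "w \<circ> refls (alternating s t n)"
    have IH: "retract w (Prod s t n) = []" "endpoint w (Prod s t n) = ?w"
      using Suc False by auto
    have hit: "hit (Suc n)" "target ?w r = x" if stay: "stays ?w r"
    proof -
      obtain x' where x': "x' \<in> X" "w b = simple_root x'"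
        using stay by (auto simp: stays_iff b)
      then have "x' = x \<and> b = q" using uniq b12 by blast
      then show "hit (Suc n)" "target ?w r = x" using x' hit_Suc by (auto intro!: target_eq simp: b)
    qed
    show ?thesis
    proof (cases "stays ?w r")
      case True
      have x: "x \<in> X" "?w (simple_root r) = simple_root x"
        using hit(1)[OF True] False hit_Suc by (auto simp: b)
      have "?w \<in> refl_group"
        using min_reps_in_refl_group[OF endpoint_in_min_reps[OF w Prod_words[OF V(1,2), of n]]] by (simp only: IH)
      then have comm: "?w \<circ> reflect r = reflect x \<circ> ?w"
        using refl_group_intertwine[of ?w r x] r x X_subset by blast
      \<comment> \<open>Standing still at this step is the same as moving on and correcting by the reflection of x.\<close>
      have "reflect x \<circ> ?w \<circ> reflect r = ?w"
      proof
        fix p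
        show "(reflect x \<circ> ?w \<circ> reflect r) p = ?w p"
          using fun_cong[OF comm, of p] subsetD[OF X_subset x(1)] by simp
      qed
      then show ?thesis
        using IH True hit[OF True] by (simp add: P retract_append endpoint_append alt o_assoc del: Prod.simps alternating.simps o_apply)
    next
      case nstay: False
      have "\<not> hit (Suc n)"
        using nstay False hit_Suc by (auto simp: stays_iff b)
      then show ?thesis
        using IH nstay by (simp add: P retract_append endpoint_append alt o_assoc del: Prod.simps alternating.simps o_apply)
    qed
  qed
qed


lemma alternating_walk_all_loops:
  assumes "w (simple_root s) = simple_root y" "w (simple_root t) = simple_root z" "y \<in> X" "z \<in> X"
  shows "retract w (Prod s t n) = Prod y z n \<and> endpoint w (Prod s t n) = w"
proof -
  have *: "stays w s" "stays w t" "target w s = y" "target w t = z"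
    using assms by (auto simp: stays_iff target_eq)
  have "(retract w (Prod s t n) = Prod y z n \<and> endpoint w (Prod s t n) = w) \<and>
        (retract w (Prod t s n) = Prod z y n \<and> endpoint w (Prod t s n) = w)"
    by (induction n) (simp_all add: *)
  then show ?thesis by simp
qed

text \<open>
  The preimages of \<open>\<alpha>\<^sub>x\<close> and \<open>\<alpha>\<^sub>x\<^sub>'\<close> are nonnegative combinations of \<open>\<alpha>\<^sub>s\<close> and \<open>\<alpha>\<^sub>t\<close>.
  Conversely \<open>w \<alpha>\<^sub>s\<close> and \<open>w \<alpha>\<^sub>t\<close> are combinations of \<open>\<alpha>\<^sub>x\<close> and \<open>\<alpha>\<^sub>x\<^sub>'\<close> with coefficients of one
  sign each, since they are roots.  Solving the linear system shows that this is possible only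
  if the two pairs correspond up to order.
\<close>

lemma plane_simple_roots:
  assumes w: "w \<in> min_reps" and st: "s \<in> V" "t \<in> V" "s \<noteq> t"
    and x: "x \<in> X" "x' \<in> X" "x \<noteq> x'"
    and p: "w (lincomb a (simple_root s) b (simple_root t)) = simple_root x"
    and p': "w (lincomb a' (simple_root s) b' (simple_root t)) = simple_root x'"
  shows "(w (simple_root s) = simple_root x \<and> w (simple_root t) = simple_root x') \<or>
         (w (simple_root s) = simple_root x' \<and> w (simple_root t) = simple_root x)"
proof -
  have wW: "w \<in> refl_group" using w by (rule min_reps_in_refl_group)
  \<comment> \<open>A multiple of a simple root that is sent to a simple root is that simple root, by its norm.\<close>
  have ray: "w (simple_root r) = simple_root z"
    if "0 \<le> c" "w (lincomb c (simple_root r) 0 q) = simple_root z" "r \<in> V" "z \<in> X" for c r q z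
  proof -
    have "form (lincomb c (simple_root r) 0 q) (lincomb c (simple_root r) 0 q) = 1"
      using refl_group_form[OF wW, of "lincomb c (simple_root r) 0 q" "lincomb c (simple_root r) 0 q"] that X_subset
      by auto
    then have "lincomb c (simple_root r) 0 q = simple_root r"
      using that by (intro unit_on_axis_eq_simple_root) (auto simp: nonneg_def lincomb_def simple_root_def)
    then show ?thesis using that(2) by simp
  qed
  have swap: "lincomb c u d v = lincomb d v c u" for c u d v
    by (simp add: lincomb_def add.commute)
  have nonzero: "c \<noteq> 0 \<or> d \<noteq> 0" if "w (lincomb c u d v) = simple_root z" for c u d v z
    using fun_cong[OF that, of z]
    by (simp add: refl_group_lincomb[OF wW]) (auto simp: lincomb_def simple_root_def)
  have ge: "0 \<le> a" "0 \<le> b" "0 \<le> a'" "0 \<le> b'"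
    using nonneg_lincomb_simple_roots[OF min_reps_nonneg[OF w x(1) p] st(3)]
      nonneg_lincomb_simple_roots[OF min_reps_nonneg[OF w x(2) p'] st(3)] by simp_all
  define f where "f = w (simple_root s)"
  define g where "g = w (simple_root t)"
  have eqs: "a * f z + b * g z = simple_root x z" "a' * f z + b' * g z = simple_root x' z" for z
    using fun_cong[OF p, of z] fun_cong[OF p', of z]
    by (simp_all add: refl_group_lincomb[OF wW] f_def g_def) (simp_all add: lincomb_def)
  \<comment> \<open>Coordinates of a root never have opposite signs.\<close>
  have opp: "0 \<le> f x * f x'" "0 \<le> g x * g x'"
    using refl_group_sign[OF wW st(1)] refl_group_sign[OF wW st(2)]
    by (auto simp: f_def g_def nonneg_def nonpos_def mult_nonpos_nonpos)
  define D where "D = a * b' - a' * b"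
  \<comment> \<open>Cramer's rule; the values at x and x' are b' and - b.\<close>
  have Df: "D * f z = b' * simple_root x z - b * simple_root x' z" for z
    by (simp add: eqs[symmetric] D_def algebra_simps)
  have "(D * f x) * (D * f x') = b' * (- b)"
    unfolding Df using x(3) by (simp add: simple_root_def)
  then have "(D * D) * (f x * f x') = - (b * b')"
    by (simp add: mult_ac)
  moreover have "0 \<le> (D * D) * (f x * f x')"
    by (rule mult_nonneg_nonneg[OF zero_le_square opp(1)])
  ultimately have "b * b' \<le> 0" by linarith
  then have b0: "b = 0 \<or> b' = 0"
    using ge(2,4) by (simp add: mult_le_0_iff) linarith
  have Dg: "D * g z = a * simple_root x' z - a' * simple_root x z" for z
    by (simp add: eqs[symmetric] D_def algebra_simps)
  have "(D * g x) * (D * g x') = (- a') * a"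
    unfolding Dg using x(3) by (simp add: simple_root_def)
  then have "(D * D) * (g x * g x') = - (a * a')"
    by (simp add: mult_ac)
  moreover have "0 \<le> (D * D) * (g x * g x')"
    by (rule mult_nonneg_nonneg[OF zero_le_square opp(2)])
  ultimately have "a * a' \<le> 0" by linarith
  then have a0: "a = 0 \<or> a' = 0"
    using ge(1,3) by (simp add: mult_le_0_iff) linarith
  show ?thesis
  proof (cases "b = 0")
    case True
    then have "a' = 0" using a0 nonzero[OF p] by auto
    then have "w (simple_root t) = simple_root x'"
      using ray[of b' t "simple_root s" x'] p' ge st x swap[of 0 "simple_root s"] by simp
    moreover have "w (simple_root s) = simple_root x"
      using ray[of a s "simple_root t" x] p ge st x True by simp
    ultimately show ?thesis by simp
  next
    case False
    then have b': "b' = 0" using b0 by simp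
    then have "a = 0" using a0 nonzero[OF p'] by auto
    then have "w (simple_root t) = simple_root x"
      using ray[of b t "simple_root s" x] p ge st x swap[of 0 "simple_root s"] by simp
    moreover have "w (simple_root s) = simple_root x'"
      using ray[of a' s "simple_root t" x'] p' ge st x b' by simp
    ultimately show ?thesis by simp
  qed
qed

text \<open>
  If the plane of \<open>\<alpha>\<^sub>s\<close> and \<open>\<alpha>\<^sub>t\<close> contains two vectors that \<open>w\<close> sends to distinct simple roots
  from \<open>X\<close>, the walk stays put and writes a braid relation, whose label is the same because \<open>w\<close>
  is an isometry.  If it contains at most one, both walks meet the same roots, so they write
  the same word, and they end at the same point.
\<close>

lemma retract_braid:
  assumes w: "w \<in> min_reps" and e: "{s, t} \<in> E"
  shows "retract w (Prod s t (m {s, t})) \<approx> retract w (Prod t s (m {s, t})) \<and>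
    endpoint w (Prod s t (m {s, t})) = endpoint w (Prod t s (m {s, t}))"
proof -
  have e': "{t, s} \<in> E" "{t, s} = {s, t}" using e by (simp_all add: insert_commute)
  have V: "s \<in> V" "t \<in> V" "s \<noteq> t"
    using edges[OF e] edge_distinct[OF e] by auto
  have wW: "w \<in> refl_group" using w by (rule min_reps_in_refl_group)
  let ?span = "\<lambda>a b. lincomb a (simple_root s) b (simple_root t)"
  show ?thesis
  proof (cases "\<exists>x\<in>X. \<exists>x'\<in>X. \<exists>a b a' b'. x \<noteq> x' \<and>
      w (?span a b) = simple_root x \<and> w (?span a' b') = simple_root x'")
    case True
    then obtain y z where yz: "w (simple_root s) = simple_root y" "w (simple_root t) = simple_root z"
      "y \<in> X" "z \<in> X" "y \<noteq> z"
      using plane_simple_roots[OF w V] by metis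
    have "gram y z = gram s t"
      using refl_group_form[OF wW, of "simple_root s" "simple_root t"] V yz(1,2)
        subsetD[OF X_subset yz(3)] subsetD[OF X_subset yz(4)] by simp
    then have "{y, z} \<in> E \<and> m {y, z} = m {s, t}"
      using gram_determines_label[OF e yz(5)] by simp
    then have "(Prod y z (m {s, t}), Prod z y (m {s, t})) \<in> artin_relations E m"
      unfolding artin_relations_def by (intro CollectI exI[of _ y] exI[of _ z]) simp
    then show ?thesis
      using alternating_walk_all_loops[OF yz(1-4)] alternating_walk_all_loops[OF yz(2,1,4,3)]
      by (auto intro: pres_eq.relation)
  next
    case False
    obtain x q where uniq: "\<And>x' a b. x' \<in> X \<Longrightarrow> w (?span a b) = simple_root x' \<Longrightarrow>
      x' = x \<and> ?span a b = q"
    proof (cases "\<exists>x\<in>X. \<exists>a b. w (?span a b) = simple_root x")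
      case True
      then obtain x a b where x: "x \<in> X" "w (?span a b) = simple_root x" by blast
      obtain v where "\<And>p. v (w p) = p" using refl_group_inverse[OF wW] by metis
      then show thesis
        using that[of x "?span a b"] x False by metis
    next
      case False
      then show thesis using that by blast
    qed
    have uniq': "x' = x \<and> lincomb a (simple_root t) b (simple_root s) = q"
      if "x' \<in> X" "w (lincomb a (simple_root t) b (simple_root s)) = simple_root x'" for x' a b
    proof -
      have "lincomb a (simple_root t) b (simple_root s) = ?span b a"
        by (auto simp: lincomb_def)
      then show ?thesis using uniq[of x' b a] that by simp
    qed
    have "(\<exists>i<m {s, t}. q = dihedral_root s t i) \<longleftrightarrow> (\<exists>i<m {s, t}. q = dihedral_root t s i)"
      using dihedral_roots_commute[OF e, of q] dihedral_roots_commute[OF e'(1), of q] e'(2) by auto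
    moreover define hit where "hit \<longleftrightarrow> x \<in> X \<and> w q = simple_root x \<and> (\<exists>i<m {s, t}. q = dihedral_root s t i)"
    ultimately have hit': "hit \<longleftrightarrow> x \<in> X \<and> w q = simple_root x \<and> (\<exists>i<m {s, t}. q = dihedral_root t s i)"
      by simp
    have "retract w (Prod s t (m {s, t})) = (if hit then [(x, True)] else []) \<and>
      endpoint w (Prod s t (m {s, t})) = (if hit then reflect x \<circ> w \<circ> refls (alternating s t (m {s, t}))
                                      else w \<circ> refls (alternating s t (m {s, t})))"
      unfolding hit_def by (rule alternating_walk_one_loop[OF e w order.refl uniq])
    moreover have "retract w (Prod t s (m {s, t})) = (if hit then [(x, True)] else []) \<and>
      endpoint w (Prod t s (m {s, t})) = (if hit then reflect x \<circ> w \<circ> refls (alternating t s (m {s, t}))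
                                      else w \<circ> refls (alternating t s (m {s, t})))"
      unfolding hit' by (rule alternating_walk_one_loop[OF e'(1) w _ uniq']) (simp_all only: e'(2) order.refl)
    moreover have "(if hit then [(x, True)] else []) \<in> words V"
      using X_subset by (auto simp: words_def hit_def)
    ultimately show ?thesis
      unfolding braid_refls[OF e] by (simp only: pres_eq.refl simp_thms)
  qed
qed

text \<open>
  The well-definedness of the retraction onto \<open>A\<^sub>X\<close>, for the walk from an arbitrary starting
  point, since the second factor of a product is read from the endpoint of the first.
\<close>

lemma retract_word_eq:
  assumes "u \<approx> v" "w \<in> min_reps"
  shows "retract w u \<approx> retract w v \<and> endpoint w u = endpoint w v"
  using assms
proof (induction arbitrary: w rule: pres_eq.induct)
  case (relation u v)
  then show ?case using retract_braid by (auto simp: artin_relations_def)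
next
  case (cancel s b)
  show ?case
  proof (cases "stays w s")
    case True
    then have "target w s \<in> V" using target_in_X X_subset by auto
    then show ?thesis using True by (simp add: pres_eq.cancel)
  next
    case False
    \<comment> \<open>Staying there would require the negative of a simple root to be nonnegative.\<close>
    have "\<not> stays (w \<circ> reflect s) s"
    proof
      assume "stays (w \<circ> reflect s) s"
      then obtain x where x: "x \<in> X" "w (reflect s (simple_root s)) = simple_root x"
        by (auto simp: stays_iff)
      have "0 \<le> reflect s (simple_root s) s"
        using min_reps_nonneg[OF cancel(2) x] by (simp add: nonneg_def)
      then show False
        using cancel(1) by (simp add: reflect_def) (simp add: simple_root_def)
    qed
    moreover have "w \<circ> reflect s \<circ> reflect s = w" using cancel by (auto simp: fun_eq_iff)
    ultimately show ?thesis using False by (simp add: pres_eq.refl words_def del: o_apply)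
  qed
next
  case (refl u)
  have "retract w u \<in> words V" using retract_words[of w u] X_subset by (auto simp: words_def)
  then show ?case by (simp add: pres_eq.refl)
next
  case (append u u' v v')
  then have "endpoint w u \<in> min_reps" using P.pres_eq_words endpoint_in_min_reps by blast
  then show ?case
    using append by (auto simp: retract_append endpoint_append intro: pres_eq.append)
qed (auto intro: pres_eq.sym pres_eq.trans)

section \<open>Conjugates contained in a standard parabolic subgroup\<close>

lemma refls_word_eq: "u \<approx> v \<Longrightarrow> rho u = rho v"
proof (induction rule: pres_eq.induct)
  case (relation u v)
  then show ?case
    using braid_refls by (auto simp: artin_relations_def Prod_eq_map_alternating comp_def)
next
  case (append u u' v v')
  then show ?case by (intro ext) simp
qed (auto simp: fun_eq_iff)

lemma word_fixed: "u \<in> words X \<Longrightarrow> retract id u = u \<and> endpoint id u = id"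
proof (induction u)
  case (Cons l u)
  obtain x b where l: "l = (x, b)" by (cases l)
  have "stays id x" "target id x = x" using Cons.prems by (auto simp: l words_Cons stays_iff target_eq)
  then have "retract id (l # u) = l # retract id u" "endpoint id (l # u) = endpoint id u"
    by (simp_all add: l)
  then show ?case using Cons by (simp only: l words_Cons)
qed simp

lemma nonneg_refl_group_image:
  assumes "finite S" "nonneg p" "\<And>u. u \<notin> S \<Longrightarrow> p u = 0" "v \<in> refl_group"
    and "\<And>x. x \<in> S \<Longrightarrow> nonneg (v (simple_root x))"
  shows "nonneg (v p)"
  using assms
proof (induction S arbitrary: p rule: finite_induct)
  case empty
  then have p: "p = lincomb 0 p 0 p" by (auto simp: lincomb_def)
  have "v p = lincomb 0 (v p) 0 (v p)" 
    using refl_group_lincomb[OF \<open>v \<in> refl_group\<close>, of 0 p 0 p] unfolding p[symmetric] by assumption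
  then show ?case by (auto simp: lincomb_def nonneg_def fun_eq_iff)
next
  case (insert x S)
  have p: "p = lincomb 1 (p(x := 0)) (p x) (simple_root x)"
    by (auto simp: lincomb_def simple_root_def)
  have "nonneg (v (p(x := 0)))"
    by (rule insert.IH) (use insert.prems in \<open>auto simp: nonneg_def\<close>)
  moreover have "nonneg (v (simple_root x))" "0 \<le> p x"
    using insert.prems by (auto simp: nonneg_def)
  moreover have "v p = lincomb 1 (v (p(x := 0))) (p x) (v (simple_root x))"
    using refl_group_lincomb[OF insert.prems(3), of 1 "p(x := 0)" "p x" "simple_root x"]
    unfolding p[symmetric] by assumption
  ultimately show ?case by (auto simp: lincomb_def nonneg_def)
qed

lemma refls_outside: "u \<in> words X \<Longrightarrow> z \<notin> X \<Longrightarrow> rho u p z = p z"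
  by (induction u) (auto simp: words_def reflect_def)

text \<open>
  Put \<open>p = w \<alpha>\<^sub>y\<close>, where \<open>w\<close> is the endpoint of \<open>a\<close>.  The given equation turns the action of
  \<open>s\<^sub>y\<close> on \<open>\<alpha>\<^sub>y\<close> into an element of \<open>W\<^sub>X\<close> that sends \<open>p\<close> to \<open>- p\<close>.  Elements of \<open>W\<^sub>X\<close> leave
  coordinates outside \<open>X\<close> unchanged, so \<open>p\<close> is supported on \<open>X\<close>.  Now \<open>\<alpha>\<^sub>y = w\<inverse> p\<close> is a
  nonnegative combination of the nonnegative roots \<open>w\<inverse> \<alpha>\<^sub>x\<close>; as \<open>\<alpha>\<^sub>y\<close> spans an extreme ray of
  the cone of nonnegative vectors, every \<open>w\<inverse> \<alpha>\<^sub>x\<close> that occurs equals \<open>\<alpha>\<^sub>y\<close>.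
\<close>

lemma conjugate_generator_stays:
  assumes a: "a \<in> words V" and y: "y \<in> V" and e: "e \<in> words X"
    and eq: "a @ [(y, True)] \<approx> e @ a"
    and pos: "nonneg (endpoint id a (simple_root y))"
  shows "stays (endpoint id a) y"
proof -
  define w where "w = endpoint id a"
  define p where "p = w (simple_root y)"
  let ?c = "retract id a"
  have w: "w \<in> min_reps" using endpoint_in_min_reps[OF id_in_min_reps a] by (simp add: w_def)
  have wW: "w \<in> refl_group" using w by (rule min_reps_in_refl_group)
  have decomp: "rho a q = rho ?c (w q)" for q
    using refls_retract_endpoint[OF id_in_min_reps a, of q] by (simp add: w_def)
  have "rho a (reflect y (simple_root y)) = rho e (rho a (simple_root y))"
    using fun_cong[OF refls_word_eq[OF eq], of "simple_root y"] by simp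
  then have "rho ?c (lincomb (- 1) p 0 p) = rho e (rho ?c p)"
    using y by (simp add: decomp reflect_simple_root[of y "simple_root y"] refl_group_lincomb[OF wW])
      (simp add: lincomb_def p_def)
  then have "lincomb (- 1) p 0 p z = p z" if "z \<notin> X" for z
    using refls_outside[OF retract_words that] refls_outside[OF e that] by metis
  then have supp: "p z = 0" if "z \<notin> X" for z
    using that by (simp add: lincomb_def)
  have "\<exists>x. p x \<noteq> 0"
  proof (rule ccontr)
    assume "\<nexists>x. p x \<noteq> 0"
    then have "form p p = 0" by (simp add: form_def)
    then show False using form_root[OF wW y] by (simp add: p_def)
  qed
  then obtain x where x: "p x > 0" "x \<in> X"
    using pos supp by (force simp: nonneg_def p_def w_def less_le)
  obtain v where v: "v \<in> refl_group" "\<And>q. w (v q) = q" "\<And>q. v (w q) = q"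
    using refl_group_inverse[OF wW] by metis
  have posv: "nonneg (v (simple_root x'))" if "x' \<in> X" for x'
    using min_reps_nonneg[OF w that] v(2) by simp
  have p: "p = lincomb 1 (p(x := 0)) (p x) (simple_root x)"
    by (auto simp: lincomb_def simple_root_def)
  have "nonneg (v (p(x := 0)))"
  proof (rule nonneg_refl_group_image[OF finite_subset[OF X_subset finite_vertices] _ _ v(1) posv])
    show "nonneg (p(x := 0))" using pos by (simp add: nonneg_def p_def w_def)
    show "(p(x := 0)) u = 0" if "u \<notin> X" for u using supp[OF that] by simp
  qed
  then have ge: "0 \<le> v (p(x := 0)) u" "0 \<le> v (simple_root x) u" for u
    using posv[OF x(2)] by (auto simp: nonneg_def)
  have "v p = lincomb 1 (v (p(x := 0))) (p x) (v (simple_root x))"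
    using refl_group_lincomb[OF v(1), of 1 "p(x := 0)" "p x" "simple_root x"]
    unfolding p[symmetric] by assumption
  moreover have "v p = simple_root y"
    by (simp add: p_def v(3))
  ultimately have sum: "simple_root y u = v (p(x := 0)) u + p x * v (simple_root x) u" for u
    by (simp add: lincomb_def)
  have "v (simple_root x) u = 0" if "u \<noteq> y" for u
  proof -
    have "v (p(x := 0)) u + p x * v (simple_root x) u = 0"
      using sum[of u] that by (simp add: simple_root_def[of y])
    then show ?thesis
      using ge[of u] mult_nonneg_nonneg[of "p x" "v (simple_root x) u"] x(1) by (auto simp: add_nonneg_eq_0_iff)
  qed
  then have "v (simple_root x) = simple_root y"
    using posv[OF x(2)] form_root[OF v(1), of x] subsetD[OF X_subset x(2)] y
    by (intro unit_on_axis_eq_simple_root) simp_all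
  then have "w (simple_root y) = simple_root x" using v(2) by metis
  then show ?thesis using x by (auto simp: stays_iff w_def)
qed

text \<open>
  Choose \<open>b\<close> so that the endpoint \<open>w\<close> of \<open>a b\<close> has minimal length.  If the walk stays at \<open>w\<close> on
  \<open>y\<close>, then \<open>w \<alpha>\<^sub>y\<close> is a simple root.  Otherwise \<open>w s\<^sub>y\<close> is the endpoint of \<open>a b \<sigma>\<^sub>y\<close> and is
  not shorter, so \<open>w \<alpha>\<^sub>y\<close> is nonnegative.
\<close>

lemma minimal_translate:
  assumes a: "a \<in> words V" and Y: "Y \<subseteq> V"
  obtains b where "b \<in> words Y" "\<And>y. y \<in> Y \<Longrightarrow> nonneg (endpoint id (a @ b) (simple_root y))"
proof -
  define Q where "Q = (\<lambda>(b, ws). b \<in> words Y \<and> ws \<in> lists V \<and> endpoint id (a @ b) = refls ws)"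
  have "endpoint id a \<in> refl_group" using min_reps_in_refl_group endpoint_in_min_reps[OF id_in_min_reps a] by blast
  then obtain ws0 where "Q ([], ws0)" by (auto simp: Q_def refl_group_def words_def)
  then obtain bw where bw: "Q bw" "\<And>bw'. Q bw' \<Longrightarrow> length (snd bw) \<le> length (snd bw')"
    using ex_has_least_nat[of Q _ "\<lambda>bw. length (snd bw)"] by blast
  obtain b ws where [simp]: "bw = (b, ws)" by (cases bw)
  have b: "b \<in> words Y" and ws: "ws \<in> lists V" and eq: "endpoint id (a @ b) = refls ws"
    using bw(1) by (auto simp: Q_def)
  have least: "length ws \<le> length ws'" if "Q (b', ws')" for b' ws'
    using bw(2)[OF that] by simp
  have "nonneg (endpoint id (a @ b) (simple_root y))" if y: "y \<in> Y" for y
  proof (cases "stays (endpoint id (a @ b)) y")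
    case True
    then show ?thesis by (auto elim: staysE)
  next
    case False
    have "nonneg (refls ws (simple_root y))"
    proof (rule root_nonneg[OF ws])
      show "y \<in> V" using y Y by auto
      fix ws' assume ws': "ws' \<in> lists V"
      show "length ws \<le> length ws'" if "refls ws' = refls ws"
        using least[of b ws'] that ws' b eq by (simp add: Q_def)
      assume "refls ws' = refls (ws @ [y])"
      also have "\<dots> = refls ws \<circ> reflect y"
        by (intro ext) simp
      also have "\<dots> = endpoint id (a @ b @ [(y, True)])"
        using endpoint_append[of id "a @ b" "[(y, True)]"] False by (simp add: eq del: o_apply)
      finally show "length ws \<le> length ws'"
        using least[of "b @ [(y, True)]" ws'] ws' b y by (simp add: Q_def words_def)
    qed
    then show ?thesis by (simp add: eq)
  qed
  then show thesis using that b by blast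
qed


lemma retract_stable:
  assumes "\<And>y. y \<in> Y \<Longrightarrow> stays w y" "b \<in> words Y"
  shows "endpoint w b = w \<and> retract w b = map (map_prod (target w) id) b"
  using assms(2)
proof (induction b)
  case (Cons l b)
  then show ?case using assms(1) by (cases l) (simp add: words_Cons del: o_apply)
qed simp

lemma words_image: "words (f ` Y) = map (map_prod f id) ` words Y"
proof -
  have "f ` Y \<times> UNIV = map_prod f id ` (Y \<times> (UNIV :: bool set))"
    by (simp add: map_prod_surj_on)
  then show ?thesis by (simp add: words_def lists_image)
qed

text \<open>
  The retraction applied to both sides: the word \<open>e\<close> over \<open>X\<close> is copied and leads back to the
  starting point.
\<close>

lemma conjugate_retract:
  assumes a: "a \<in> words V" and e: "e \<in> words X" and eq: "a @ b \<approx> e @ a"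
  shows "retract id a @ retract (endpoint id a) b \<approx> e @ retract id a"
  using retract_word_eq[OF eq id_in_min_reps] word_fixed[OF e] by (simp add: retract_append)

abbreviation G where "G \<equiv> pres_group V (artin_relations E m)"

lemma words_mono: "S \<subseteq> T \<Longrightarrow> u \<in> words S \<Longrightarrow> u \<in> words T"
  by (auto simp: words_def)

lemma standard_parabolic_eq:
  assumes Z: "Z \<subseteq> V"
  shows "standard_parabolic V E m Z = P.cls ` words Z"
proof -
  interpret G: group G by (rule P.group_pres_group)
  have gen: "artin_gen V E m z = P.cls [(z, True)]" for z
    by (simp add: artin_gen_def pres_gen_def)
  have ginv: "inv\<^bsub>G\<^esub> P.cls [(z, True)] = P.cls [(z, False)]" if "z \<in> Z" for z
    using P.inv_pres_gen[of z] that Z by (auto simp: pres_gen_def)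
  have "standard_parabolic V E m Z = generate G ((\<lambda>z. P.cls [(z, True)]) ` Z)"
    by (simp add: standard_parabolic_def artin_group_def gen)
  also have "\<dots> = P.cls ` words Z"
  proof
    show "generate G ((\<lambda>z. P.cls [(z, True)]) ` Z) \<subseteq> P.cls ` words Z"
    proof
      fix h assume "h \<in> generate G ((\<lambda>z. P.cls [(z, True)]) ` Z)"
      then show "h \<in> P.cls ` words Z"
      proof (induction rule: generate.induct)
        case one
        then show ?case by (auto simp: P.one_cls words_def)
      next
        case (incl h)
        then show ?case by (auto simp: words_def)
      next
        case (inv h)
        then obtain z where z: "z \<in> Z" "h = P.cls [(z, True)]" by auto
        then have "inv\<^bsub>G\<^esub> h = P.cls [(z, False)]" using ginv by simp
        then show ?case using z by (auto simp: words_def)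
      next
        case (eng h1 h2)
        then obtain u v where uv: "u \<in> words Z" "v \<in> words Z" "h1 = P.cls u" "h2 = P.cls v" by auto
        then have "h1 \<otimes>\<^bsub>G\<^esub> h2 = P.cls (u @ v)"
          using words_mono[OF Z] by (simp add: P.mult_cls)
        then show ?case using uv by (auto simp: words_def)
      qed
    qed
    have "P.cls u \<in> generate G ((\<lambda>z. P.cls [(z, True)]) ` Z)" if "u \<in> words Z" for u
      using that
    proof (induction u)
      case Nil
      then show ?case using generate.one[of G] by (simp add: P.one_cls)
    next
      case (Cons l u)
      obtain z b where l: "l = (z, b)" by (cases l)
      have z: "z \<in> Z" and u: "u \<in> words Z" using Cons.prems by (auto simp: l words_Cons)
      have "P.cls [l] \<in> generate G ((\<lambda>z. P.cls [(z, True)]) ` Z)"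
        using z ginv[OF z, symmetric] by (cases b) (auto simp: l intro: generate.incl generate.inv)
      then have "P.cls [l] \<otimes>\<^bsub>G\<^esub> P.cls u \<in> generate G ((\<lambda>z. P.cls [(z, True)]) ` Z)"
        using Cons.IH[OF u] by (rule generate.eng)
      moreover have "[l] \<in> words V" "u \<in> words V"
        using z u words_mono[OF Z] Z by (auto simp: l words_def)
      ultimately show ?case by (simp add: P.mult_cls)
    qed
    then show "P.cls ` words Z \<subseteq> generate G ((\<lambda>z. P.cls [(z, True)]) ` Z)" by blast
  qed
  finally show ?thesis .
qed

lemma conjugate_cls_iff:
  assumes "a \<in> words V" "u \<in> words V" "e \<in> words V"
  shows "P.cls a \<otimes>\<^bsub>G\<^esub> P.cls u \<otimes>\<^bsub>G\<^esub> inv\<^bsub>G\<^esub> P.cls a = P.cls e \<longleftrightarrow> a @ u \<approx> e @ a"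
proof -
  interpret G: group G by (rule P.group_pres_group)
  have "P.cls e = P.cls a \<otimes>\<^bsub>G\<^esub> P.cls u \<otimes>\<^bsub>G\<^esub> inv\<^bsub>G\<^esub> P.cls a \<longleftrightarrow>
    P.cls a \<otimes>\<^bsub>G\<^esub> P.cls u = P.cls e \<otimes>\<^bsub>G\<^esub> P.cls a"
    using assms by (intro G.inv_solve_right) (simp_all add: P.cls_carrier)
  also have "\<dots> \<longleftrightarrow> a @ u \<approx> e @ a"
    using assms by (simp add: P.mult_cls P.cls_eq_iff P.words_append)
  finally show ?thesis by auto
qed

text \<open>
  The conjugating element \<open>\<gamma>\<close> is the retraction of \<open>\<alpha> \<beta>\<close>, where \<open>\<beta> \<in> A\<^sub>Y\<close> is chosen by
  \<open>minimal_translate\<close>, and \<open>Y'\<close> is the set of vertices to which the endpoint conjugates \<open>Y\<close>.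
\<close>

theorem parabolic_in_standard_parabolic:
  assumes Y: "Y \<subseteq> V" and \<alpha>: "\<alpha> \<in> carrier G"
    and sub: "\<alpha> <#\<^bsub>G\<^esub> standard_parabolic V E m Y #>\<^bsub>G\<^esub> inv\<^bsub>G\<^esub> \<alpha> \<subseteq> standard_parabolic V E m X"
  shows "\<exists>Y' \<gamma>. Y' \<subseteq> X \<and> \<gamma> \<in> standard_parabolic V E m X \<and>
    \<alpha> <#\<^bsub>G\<^esub> standard_parabolic V E m Y #>\<^bsub>G\<^esub> inv\<^bsub>G\<^esub> \<alpha> =
    \<gamma> <#\<^bsub>G\<^esub> standard_parabolic V E m Y' #>\<^bsub>G\<^esub> inv\<^bsub>G\<^esub> \<gamma>"
proof -
  interpret G: group G by (rule P.group_pres_group)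
  have conj: "\<delta> <#\<^bsub>G\<^esub> standard_parabolic V E m Z #>\<^bsub>G\<^esub> inv\<^bsub>G\<^esub> \<delta> =
      (\<lambda>u. \<delta> \<otimes>\<^bsub>G\<^esub> P.cls u \<otimes>\<^bsub>G\<^esub> inv\<^bsub>G\<^esub> \<delta>) ` words Z" if "Z \<subseteq> V" for \<delta> Z
    unfolding standard_parabolic_eq[OF that] by (auto simp: l_coset_def r_coset_def)
  obtain a0 where a0: "a0 \<in> words V" "\<alpha> = P.cls a0"
    using \<alpha> by (rule P.carrier_cases)
  obtain b where b: "b \<in> words Y" "\<And>y. y \<in> Y \<Longrightarrow> nonneg (endpoint id (a0 @ b) (simple_root y))"
    using minimal_translate[OF a0(1) Y] by blast
  define a where "a = a0 @ b"
  define w where "w = endpoint id a"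
  define c where "c = retract id a"
  have bV: "b \<in> words V" using b(1) words_mono[OF Y] by blast
  have a: "a \<in> words V" using a0 bV by (simp add: a_def P.words_append)
  have c: "c \<in> words X" "c \<in> words V"
    using retract_words[of id a] words_mono[OF X_subset] by (auto simp: c_def)
  obtain b' where b': "b' \<in> words Y" "inv\<^bsub>G\<^esub> P.cls b = P.cls b'"
  proof -
    have "inv\<^bsub>G\<^esub> P.cls b \<in> standard_parabolic V E m Y"
      unfolding standard_parabolic_def artin_group_def artin_gen_def
      by (rule G.generate_m_inv_closed)
         (use b Y standard_parabolic_eq[OF Y] in
          \<open>auto simp: standard_parabolic_def artin_group_def artin_gen_def P.pres_gen_carrier\<close>)
    then show thesis using that standard_parabolic_eq[OF Y] by auto
  qed
  have b'V: "b' \<in> words V" using b'(1) words_mono[OF Y] by blast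
  \<comment> \<open>Conjugation by d v is conjugation by v followed by conjugation by d, on the level of words.\<close>
  have shift: "P.cls (d @ v) \<otimes>\<^bsub>G\<^esub> P.cls u \<otimes>\<^bsub>G\<^esub> inv\<^bsub>G\<^esub> P.cls (d @ v) =
      P.cls d \<otimes>\<^bsub>G\<^esub> P.cls (v @ u @ v') \<otimes>\<^bsub>G\<^esub> inv\<^bsub>G\<^esub> P.cls d"
    if "d \<in> words V" "v \<in> words V" "u \<in> words V" "v' \<in> words V" "inv\<^bsub>G\<^esub> P.cls v = P.cls v'" for d v u v'
    using that by (simp add: P.mult_cls[symmetric] P.words_append G.inv_mult_group P.cls_carrier G.m_assoc)
  have "P.cls a \<otimes>\<^bsub>G\<^esub> P.cls b' = \<alpha>"
    using a0 bV b'(2) by (simp add: a_def P.mult_cls[symmetric] G.m_assoc P.cls_carrier b'(2)[symmetric])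
  then have \<alpha>_eq: "\<alpha> = P.cls (a @ b')" using a b'V by (simp add: P.mult_cls)
  have inv_b': "inv\<^bsub>G\<^esub> P.cls b' = P.cls b"
    using b'(2)[symmetric] bV by (simp add: P.cls_carrier)
  have Y_append: "u @ v \<in> words Y" if "u \<in> words Y" "v \<in> words Y" for u v
    using that by (simp add: words_def)
  have translate: "(\<lambda>u. P.cls a \<otimes>\<^bsub>G\<^esub> P.cls u \<otimes>\<^bsub>G\<^esub> inv\<^bsub>G\<^esub> P.cls a) ` words Y =
      (\<lambda>u. \<alpha> \<otimes>\<^bsub>G\<^esub> P.cls u \<otimes>\<^bsub>G\<^esub> inv\<^bsub>G\<^esub> \<alpha>) ` words Y"
  proof (intro equalityI image_subsetI)
    fix u assume u: "u \<in> words Y"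
    note uV = words_mono[OF Y u]
    show "P.cls a \<otimes>\<^bsub>G\<^esub> P.cls u \<otimes>\<^bsub>G\<^esub> inv\<^bsub>G\<^esub> P.cls a \<in>
        (\<lambda>u. \<alpha> \<otimes>\<^bsub>G\<^esub> P.cls u \<otimes>\<^bsub>G\<^esub> inv\<^bsub>G\<^esub> \<alpha>) ` words Y"
      unfolding a_def shift[OF a0(1) bV uV b'V b'(2)] a0(2)
      by (intro imageI Y_append u b(1) b'(1))
    show "\<alpha> \<otimes>\<^bsub>G\<^esub> P.cls u \<otimes>\<^bsub>G\<^esub> inv\<^bsub>G\<^esub> \<alpha> \<in>
        (\<lambda>u. P.cls a \<otimes>\<^bsub>G\<^esub> P.cls u \<otimes>\<^bsub>G\<^esub> inv\<^bsub>G\<^esub> P.cls a) ` words Y"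
      unfolding \<alpha>_eq shift[OF a b'V uV bV inv_b']
      by (intro imageI Y_append u b(1) b'(1))
  qed
  have "\<exists>e\<in>words X. a @ u \<approx> e @ a" if u: "u \<in> words Y" for u
  proof -
    have "P.cls a \<otimes>\<^bsub>G\<^esub> P.cls u \<otimes>\<^bsub>G\<^esub> inv\<^bsub>G\<^esub> P.cls a \<in> P.cls ` words X"
      using sub u unfolding conj[OF Y] translate[symmetric] standard_parabolic_eq[OF X_subset] by blast
    then obtain e where "e \<in> words X" "P.cls a \<otimes>\<^bsub>G\<^esub> P.cls u \<otimes>\<^bsub>G\<^esub> inv\<^bsub>G\<^esub> P.cls a = P.cls e"
      by auto
    then show ?thesis
      using conjugate_cls_iff[OF a words_mono[OF Y u] words_mono[OF X_subset]] by blast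
  qed
  then obtain e where e: "\<And>u. u \<in> words Y \<Longrightarrow> e u \<in> words X" "\<And>u. u \<in> words Y \<Longrightarrow> a @ u \<approx> e u @ a"
    by metis
  have stays: "stays w y" if y: "y \<in> Y" for y
  proof -
    have "[(y, True)] \<in> words Y" using y by (simp add: words_def)
    then show ?thesis
      using conjugate_generator_stays[OF a subsetD[OF Y y] e(1) e(2)] b(2)[OF y]
      by (simp add: w_def a_def)
  qed
  define Y' where "Y' = target w ` Y"
  have Y': "Y' \<subseteq> X" using stays target_in_X by (auto simp: Y'_def)
  have words_Y': "words Y' = retract w ` words Y"
    unfolding Y'_def words_image using retract_stable[OF stays] by (intro image_cong) auto
  have "P.cls a \<otimes>\<^bsub>G\<^esub> P.cls u \<otimes>\<^bsub>G\<^esub> inv\<^bsub>G\<^esub> P.cls a =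
      P.cls c \<otimes>\<^bsub>G\<^esub> P.cls (retract w u) \<otimes>\<^bsub>G\<^esub> inv\<^bsub>G\<^esub> P.cls c" if u: "u \<in> words Y" for u
  proof -
    have eV: "e u \<in> words V" and rV: "retract w u \<in> words V"
      using words_mono[OF X_subset] e(1)[OF u] retract_words by blast+
    have "P.cls a \<otimes>\<^bsub>G\<^esub> P.cls u \<otimes>\<^bsub>G\<^esub> inv\<^bsub>G\<^esub> P.cls a = P.cls (e u)"
      using conjugate_cls_iff[OF a words_mono[OF Y u] eV] e(2)[OF u] by simp
    moreover have "P.cls c \<otimes>\<^bsub>G\<^esub> P.cls (retract w u) \<otimes>\<^bsub>G\<^esub> inv\<^bsub>G\<^esub> P.cls c = P.cls (e u)"
      using conjugate_cls_iff[OF c(2) rV eV] conjugate_retract[OF a e(1)[OF u] e(2)[OF u]]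
      by (simp add: c_def w_def)
    ultimately show ?thesis by simp
  qed
  then have "\<alpha> <#\<^bsub>G\<^esub> standard_parabolic V E m Y #>\<^bsub>G\<^esub> inv\<^bsub>G\<^esub> \<alpha> =
      P.cls c <#\<^bsub>G\<^esub> standard_parabolic V E m Y' #>\<^bsub>G\<^esub> inv\<^bsub>G\<^esub> P.cls c"
    unfolding conj[OF Y] conj[OF order.trans[OF Y' X_subset]] translate[symmetric] words_Y' image_image
    by (intro image_cong) auto
  moreover have "P.cls c \<in> standard_parabolic V E m X"
    using c standard_parabolic_eq[OF X_subset] by blast
  ultimately show ?thesis using Y' by blast
qed

end

theorem theorem1p1:
  fixes V :: "'v set" and E :: "'v set set" and m :: "'v set \<Rightarrow> nat"
    and X Y :: "'v set" and \<alpha> :: "'v word set"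
  defines "A \<equiv> artin_group V E m"
  assumes "finite_simplicial_graph V E"
    and "\<forall>e\<in>E. 2 \<le> m e"
    and "X \<subseteq> V" and "Y \<subseteq> V"
    and "\<alpha> \<in> carrier A"
    and "\<alpha> <#\<^bsub>A\<^esub> standard_parabolic V E m Y #>\<^bsub>A\<^esub> inv\<^bsub>A\<^esub> \<alpha>
           \<subseteq> standard_parabolic V E m X"
  shows "\<exists>Y' \<gamma>. Y' \<subseteq> X \<and> \<gamma> \<in> standard_parabolic V E m X \<and>
    \<alpha> <#\<^bsub>A\<^esub> standard_parabolic V E m Y #>\<^bsub>A\<^esub> inv\<^bsub>A\<^esub> \<alpha> =
    \<gamma> <#\<^bsub>A\<^esub> standard_parabolic V E m Y' #>\<^bsub>A\<^esub> inv\<^bsub>A\<^esub> \<gamma>"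
proof -
  interpret artin_parabolic V E m X
    using assms(2-4)
    by (auto simp: artin_parabolic_def artin_parabolic_axioms_def artin_graph_def artin_graph_axioms_def)
  show ?thesis
    using parabolic_in_standard_parabolic[of Y \<alpha>] assms(5-7) by (simp only: A_def artin_group_def)
qed

end
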